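(* Let $M$ be an ultrahomogeneous structure (in a countable relational language). Then: (1) if $M$ has the fixed points on type spaces property (FPT), then $M$ has the externally definable Ramsey property; (2) if $\mathrm{Age}(M)$ is countable up to isomorphism, then $M$ has the externally definable Ramsey property if and only if $M$ has FPT.
   Context: All first-order languages are countable and relational. A structure $M$ is ultrahomogeneous if every isomorphism between finite substructures of $M$ extends to an automorphism of $M$. $\mathrm{Age}(M)$ is the class of finite structures embeddable in $M$; it is countable if its members lie in countably many isomorphism classes. Externally definable Ramsey property. Writing $\bar a\in\mathrm{Age}(M)$ means a structure $A\in\mathrm{Age}(M)$ together with an enumeration $\bar a$ (without repetition) of its elements. For a structure $B$, $\binom{B}{\bar a}=\{f(\bar a): f:A\to B \text{ an embedding}\}$. A $k$-colouring of $\binom{M}{\bar a}$ is a function $\chi:\binom{M}{\bar a}\to k=\{0,\dots,k-1\}$. It is externally definable if there are an elementary extension $N\succeq M$, a finite tuple $\bar e$ in $N$ and formulae $\phi_0(\bar x,\bar y),\dots,\phi_{k-1}(\bar x,\bar y)$ (no parameters) such that for all $\bar a'\in\binom{M}{\bar a}$ and $i<k$: $\chi(\bar a')=i\iff N\models\phi_i(\bar e,\bar a')$. $M$ has the externally definable Ramsey property if for all $\bar a\in\mathrm{Age}(M)$, all $k\ge 1$, all $B\in\mathrm{Age}(M)$ and every externally definable $\chi:\binom{M}{\bar a}\to k$, there is a substructure $B'\subseteq M$ with $B'\cong B$ such that $\chi$ is constant on $\binom{B'}{\bar a}$. FPT. Let $G=\mathrm{Aut}(M)$ with the pointwise convergence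 topology. $G$ acts continuously on the Stone space $S_n(M)$ of complete $n$-types over $M$ by $g\cdot p(\bar x)=\{\phi(\bar x,g\bar m):\phi(\bar x,\bar m)\in p(\bar x)\}$. A subflow of $S_n(M)$ is a non-empty closed $G$-invariant subset with the restricted action. $M$ has FPT if for every $n\ge1$ every subflow of $S_n(M)$ contains a $G$-fixed point. *)

theory Defs
  imports "HOL-Analysis.Analysis"
begin

section \<open>Relational structures\<close>

record 'r language =
  symbols :: "'r set"
  arity :: "'r \<Rightarrow> nat"

record ('r, 'a) struct =
  universe :: "'a set"
  interp :: "'r \<Rightarrow> 'a list set"

definition is_struct :: "'r language \<Rightarrow> ('r, 'a) struct \<Rightarrow> bool" where
  "is_struct L M \<longleftrightarrow>
     universe M \<noteq> {} \<and>
     (\<forall>R\<in>symbols L. interp M R \<subseteq> {xs \<in> lists (universe M). length xs = arity L R})"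

definition substruct :: "('r, 'a) struct \<Rightarrow> 'a set \<Rightarrow> ('r, 'a) struct" where
  "substruct M X = \<lparr>universe = X, interp = (\<lambda>R. interp M R \<inter> lists X)\<rparr>"

text \<open>Maps between structures are total functions on the types; only their values on the
  universe are relevant.\<close>

definition embedding ::
  "'r language \<Rightarrow> ('a \<Rightarrow> 'b) \<Rightarrow> ('r, 'a) struct \<Rightarrow> ('r, 'b) struct \<Rightarrow> bool" where
  "embedding L f A B \<longleftrightarrow>
     inj_on f (universe A) \<and> f ` universe A \<subseteq> universe B \<and>
     (\<forall>R\<in>symbols L. \<forall>xs\<in>lists (universe A). length xs = arity L R \<longrightarrow>
        (xs \<in> interp A R \<longleftrightarrow> map f xs \<in> interp B R))"

definition isomorphism ::
  "'r language \<Rightarrow> ('a \<Rightarrow> 'b) \<Rightarrow> ('r, 'a) struct \<Rightarrow> ('r, 'b) struct \<Rightarrow> bool" where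
  "isomorphism L f A B \<longleftrightarrow> embedding L f A B \<and> f ` universe A = universe B"

definition isomorphic ::
  "'r language \<Rightarrow> ('r, 'a) struct \<Rightarrow> ('r, 'b) struct \<Rightarrow> bool" where
  "isomorphic L A B \<longleftrightarrow> (\<exists>f. isomorphism L f A B)"

definition Aut :: "'r language \<Rightarrow> ('r, 'a) struct \<Rightarrow> ('a \<Rightarrow> 'a) set" where
  "Aut L M = {g. isomorphism L g M M}"

definition ultrahomogeneous :: "'r language \<Rightarrow> ('r, 'a) struct \<Rightarrow> bool" where
  "ultrahomogeneous L M \<longleftrightarrow>
     (\<forall>X Y f. finite X \<and> X \<subseteq> universe M \<and> finite Y \<and> Y \<subseteq> universe M \<and>
        isomorphism L f (substruct M X) (substruct M Y) \<longrightarrow>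
        (\<exists>g\<in>Aut L M. \<forall>x\<in>X. g x = f x))"

text \<open>Every finite structure has an isomorphic copy whose universe is a set of natural
  numbers, so \<open>nat\<close> serves as the common carrier type for the members of the age.\<close>

definition age :: "'r language \<Rightarrow> ('r, 'a) struct \<Rightarrow> ('r, nat) struct set" where
  "age L M = {A. is_struct L A \<and> finite (universe A) \<and> (\<exists>f. embedding L f A M)}"

definition countable_age :: "'r language \<Rightarrow> ('r, 'a) struct \<Rightarrow> bool" where
  "countable_age L M \<longleftrightarrow>
     countable (age L M // {(A, B). A \<in> age L M \<and> B \<in> age L M \<and> isomorphic L A B})"

section \<open>First-order formulae\<close>

text \<open>Formulae have named variables \<open>x\<^sub>0, x\<^sub>1, \<dots>\<close> and may contain parameters of type \<open>'c\<close>.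
  In a structure with elements of type \<open>'c\<close>, a parameter denotes itself.
  The datatype's map function applies a function to all parameters of a formula.\<close>

datatype 'c trm = Var nat | Par 'c

datatype (dead 'r, params: 'c) formula =
    Rel 'r "'c trm list"
  | Eq "'c trm" "'c trm"
  | Neg "('r, 'c) formula"
  | Conj "('r, 'c) formula" "('r, 'c) formula"
  | Exi nat "('r, 'c) formula"
  for map: map_params

primrec trm_vars :: "'c trm \<Rightarrow> nat set" where
  "trm_vars (Var i) = {i}"
| "trm_vars (Par c) = {}"

primrec free_vars :: "('r, 'c) formula \<Rightarrow> nat set" where
  "free_vars (Rel R ts) = (\<Union>t\<in>set ts. trm_vars t)"
| "free_vars (Eq s t) = trm_vars s \<union> trm_vars t"
| "free_vars (Neg \<phi>) = free_vars \<phi>"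
| "free_vars (Conj \<phi> \<psi>) = free_vars \<phi> \<union> free_vars \<psi>"
| "free_vars (Exi i \<phi>) = free_vars \<phi> - {i}"

primrec well_formed :: "'r language \<Rightarrow> ('r, 'c) formula \<Rightarrow> bool" where
  "well_formed L (Rel R ts) \<longleftrightarrow> R \<in> symbols L \<and> length ts = arity L R"
| "well_formed L (Eq s t) \<longleftrightarrow> True"
| "well_formed L (Neg \<phi>) \<longleftrightarrow> well_formed L \<phi>"
| "well_formed L (Conj \<phi> \<psi>) \<longleftrightarrow> well_formed L \<phi> \<and> well_formed L \<psi>"
| "well_formed L (Exi i \<phi>) \<longleftrightarrow> well_formed L \<phi>"

text \<open>\<open>formulae L C n\<close> is the set of \<open>L\<close>-formulae with parameters from \<open>C\<close> and free variables
  among \<open>x\<^sub>0, \<dots>, x\<^sub>n\<^sub>-\<^sub>1\<close>.\<close>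

definition formulae :: "'r language \<Rightarrow> 'c set \<Rightarrow> nat \<Rightarrow> ('r, 'c) formula set" where
  "formulae L C n = {\<phi>. well_formed L \<phi> \<and> params \<phi> \<subseteq> C \<and> free_vars \<phi> \<subseteq> {..<n}}"

primrec trm_val :: "(nat \<Rightarrow> 'a) \<Rightarrow> 'a trm \<Rightarrow> 'a" where
  "trm_val e (Var i) = e i"
| "trm_val e (Par c) = c"

primrec sat :: "('r, 'a) struct \<Rightarrow> (nat \<Rightarrow> 'a) \<Rightarrow> ('r, 'a) formula \<Rightarrow> bool" where
  "sat M e (Rel R ts) \<longleftrightarrow> map (trm_val e) ts \<in> interp M R"
| "sat M e (Eq s t) \<longleftrightarrow> trm_val e s = trm_val e t"
| "sat M e (Neg \<phi>) \<longleftrightarrow> \<not> sat M e \<phi>"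
| "sat M e (Conj \<phi> \<psi>) \<longleftrightarrow> sat M e \<phi> \<and> sat M e \<psi>"
| "sat M e (Exi i \<phi>) \<longleftrightarrow> (\<exists>a\<in>universe M. sat M (e(i := a)) \<phi>)"

text \<open>Satisfaction by a tuple, for formulae with free variables among \<open>x\<^sub>0, \<dots>, x\<^sub>n\<^sub>-\<^sub>1\<close> with
  \<open>n = length xs\<close>.\<close>

abbreviation sat_tuple :: "('r, 'a) struct \<Rightarrow> 'a list \<Rightarrow> ('r, 'a) formula \<Rightarrow> bool" where
  "sat_tuple M xs \<phi> \<equiv> sat M (\<lambda>i. xs ! i) \<phi>"

text \<open>On parameter-free formulae, \<open>map_params h\<close> merely changes the type.\<close>

definition elementary_embedding ::
  "'r language \<Rightarrow> ('a \<Rightarrow> 'b) \<Rightarrow> ('r, 'a) struct \<Rightarrow> ('r, 'b) struct \<Rightarrow> bool" where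
  "elementary_embedding L h M N \<longleftrightarrow>
     h ` universe M \<subseteq> universe N \<and>
     (\<forall>n. \<forall>\<phi>\<in>formulae L {} n. \<forall>xs\<in>lists (universe M). length xs = n \<longrightarrow>
        (sat_tuple M xs \<phi> \<longleftrightarrow> sat_tuple N (map h xs) (map_params h \<phi>)))"

section \<open>The externally definable Ramsey property\<close>

definition enumerates :: "'a list \<Rightarrow> ('r, 'a) struct \<Rightarrow> bool" where
  "enumerates as A \<longleftrightarrow> distinct as \<and> set as = universe A"

definition copies ::
  "'r language \<Rightarrow> ('r, 'b) struct \<Rightarrow> ('r, 'a) struct \<Rightarrow> 'a list \<Rightarrow> 'b list set" where
  "copies L B A as = {map f as | f. embedding L f A B}"

text \<open>An elementary extension of \<open>M\<close> is given by an elementary embedding \<open>h\<close> of \<open>M\<close> into a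
  structure \<open>N\<close>. Since one cannot quantify over types, the type \<open>'n\<close> of the elements of \<open>N\<close> is
  an explicit argument.\<close>

definition externally_definable ::
  "'n itself \<Rightarrow> 'r language \<Rightarrow> ('r, 'a) struct \<Rightarrow> ('r, nat) struct \<Rightarrow> nat list \<Rightarrow> nat
    \<Rightarrow> ('a list \<Rightarrow> nat) \<Rightarrow> bool" where
  "externally_definable _ L M A as k col \<longleftrightarrow>
     (\<exists>(N :: ('r, 'n) struct) h es \<phi>.
        is_struct L N \<and> elementary_embedding L h M N \<and> es \<in> lists (universe N) \<and>
        (\<forall>i<k. \<phi> i \<in> formulae L {} (length es + length as)) \<and>
        (\<forall>as'\<in>copies L M A as. \<forall>i<k. col as' = i \<longleftrightarrow> sat_tuple N (es @ map h as') (\<phi> i)))"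

definition externally_definable_Ramsey ::
  "'n itself \<Rightarrow> 'r language \<Rightarrow> ('r, 'a) struct \<Rightarrow> bool" where
  "externally_definable_Ramsey n L M \<longleftrightarrow>
     (\<forall>A\<in>age L M. \<forall>as. enumerates as A \<longrightarrow>
       (\<forall>k\<ge>1. \<forall>B\<in>age L M. \<forall>col.
          col ` copies L M A as \<subseteq> {..<k} \<and> externally_definable n L M A as k col \<longrightarrow>
          (\<exists>X\<subseteq>universe M. isomorphic L (substruct M X) B \<and>
             (\<exists>i. \<forall>as'\<in>copies L (substruct M X) A as. col as' = i))))"

section \<open>Fixed points on type spaces\<close>

text \<open>Complete \<open>n\<close>-types over \<open>M\<close>. By compactness, consistency with the elementary diagram of
  \<open>M\<close> amounts to being finitely satisfiable in \<open>M\<close>.\<close>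

definition types :: "'r language \<Rightarrow> ('r, 'a) struct \<Rightarrow> nat \<Rightarrow> ('r, 'a) formula set set" where
  "types L M n =
     {p. p \<subseteq> formulae L (universe M) n \<and>
         (\<forall>F\<subseteq>p. finite F \<longrightarrow>
            (\<exists>xs\<in>lists (universe M). length xs = n \<and> (\<forall>\<phi>\<in>F. sat_tuple M xs \<phi>))) \<and>
         (\<forall>\<phi>\<in>formulae L (universe M) n. \<phi> \<in> p \<or> Neg \<phi> \<in> p)}"

definition Stone_space ::
  "'r language \<Rightarrow> ('r, 'a) struct \<Rightarrow> nat \<Rightarrow> ('r, 'a) formula set topology" where
  "Stone_space L M n =
     topology_generated_by ((\<lambda>\<phi>. {p \<in> types L M n. \<phi> \<in> p}) ` formulae L (universe M) n)"

lemma topspace_Stone_space: "topspace (Stone_space L M n) = types L M n"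
proof -
  have *: "Exi 0 (Eq (Var 0) (Var 0)) \<in> formulae L (universe M) n"
    by (simp add: formulae_def)
  have "\<exists>\<phi>\<in>formulae L (universe M) n. \<phi> \<in> p" if "p \<in> types L M n" for p
    using that * unfolding types_def by blast
  then show ?thesis
    unfolding Stone_space_def topology_generated_by_topspace by auto
qed

definition type_action ::
  "('a \<Rightarrow> 'a) \<Rightarrow> ('r, 'a) formula set \<Rightarrow> ('r, 'a) formula set" where
  "type_action g p = map_params g ` p"

definition subflow ::
  "'r language \<Rightarrow> ('r, 'a) struct \<Rightarrow> nat \<Rightarrow> ('r, 'a) formula set set \<Rightarrow> bool" where
  "subflow L M n Y \<longleftrightarrow>
     Y \<noteq> {} \<and> closedin (Stone_space L M n) Y \<and>
     (\<forall>g\<in>Aut L M. \<forall>p\<in>Y. type_action g p \<in> Y)"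

definition FPT :: "'r language \<Rightarrow> ('r, 'a) struct \<Rightarrow> bool" where
  "FPT L M \<longleftrightarrow>
     (\<forall>n\<ge>1. \<forall>Y. subflow L M n Y \<longrightarrow> (\<exists>p\<in>Y. \<forall>g\<in>Aut L M. type_action g p = p))"

end

(* If p is a fixed point in the closure of the orbit of the type q of the tuple defining a
   colouring chi, then p gives all copies of A the same colour, because they are conjugate by
   ultrahomogeneity, and on a finite part of M the type p agrees with a translate of q; so chi is
   constant on a copy of B. Conversely, let q be a member of a subflow. It is realised in an
   elementary extension, so each formula phi(x,m) colours the copies of m by its truth value, and
   the Ramsey property, applied to the structure on finitely many translates of m, yields a
   translate of q that decides these translates of phi in the same way. Compactness of the Stone
   space gives all translates of phi at once, and since the types that treat phi invariantly form
   a subflow, induction and compactness give all formulae at once. The realisation of q lies in a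
   Skolem hull inside an ultrapower, whose cardinality is bounded by that of M and aleph_0. *)
theory Submission
  imports Defs
begin

text \<open>External definability fixes the element type of \<open>N\<close> before \<open>q\<close>
  is known, so the realisation of \<open>q\<close> must fit into one given type, and a full
  ultrapower may be too large for it. Los's theorem only needs, for each existential formula, one
  function that picks witnesses at all indices; a set of functions closed under such choices is
  therefore enough. The indices are tuples of \<open>M\<close> itself: as types are defined by
  finite satisfiability in \<open>M\<close>, the sets of tuples satisfying the single formulae of
  \<open>q\<close> have the finite intersection property, and the coordinate functions realise
  \<open>q\<close>. A second obstacle is syntactic. Colourings are defined by parameter-free
  formulae, whereas types consist of formulae with parameters in \<open>M\<close>, so parameters
  have to be exchanged for variables and back without capture. A single use of the Ramsey property
  handles one formula and finitely many automorphisms. Compactness over the group therefore precedes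
  compactness over the formulae, and each further formula is treated inside the subflow already
  reached, so that earlier invariance is not lost.\<close>

section \<open>Syntax\<close>

text \<open>\<open>\<sigma>\<close> acts on whole terms, parameters included, so one recursion turns
  parameters into variables and back, and may change the parameter type. No search for fresh names
  takes place: quantifiers are relabelled \<open>l\<close>, \<open>l + 1\<close>, ... by nesting
  depth.\<close>

primrec rename :: "nat \<Rightarrow> ('c trm \<Rightarrow> 'd trm) \<Rightarrow> ('r, 'c) formula \<Rightarrow> ('r, 'd) formula" where
  "rename l \<sigma> (Rel R ts) = Rel R (map \<sigma> ts)"
| "rename l \<sigma> (Eq s t) = Eq (\<sigma> s) (\<sigma> t)"
| "rename l \<sigma> (Neg \<phi>) = Neg (rename l \<sigma> \<phi>)"
| "rename l \<sigma> (Conj \<phi> \<psi>) = Conj (rename l \<sigma> \<phi>) (rename l \<sigma> \<psi>)"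
| "rename l \<sigma> (Exi i \<phi>) = Exi l (rename (Suc l) (\<sigma>(Var i := Var l)) \<phi>)"

lemma finite_free_vars: "finite (free_vars \<phi>)"
proof (induction \<phi>)
  case (Rel R ts)
  have "finite (trm_vars t)" for t :: "'b trm" by (cases t) auto
  then show ?case by simp
next
  case (Eq s t)
  have "finite (trm_vars t)" for t :: "'b trm" by (cases t) auto
  then show ?case by simp
qed auto

lemma finite_params: "finite (params \<phi>)"
proof (induction \<phi>)
  case (Rel R ts)
  have "finite (set_trm t)" for t :: "'b trm" by (cases t) auto
  then show ?case by simp
next
  case (Eq s t)
  have "finite (set_trm t)" for t :: "'b trm" by (cases t) auto
  then show ?case by simp
qed auto

lemma free_vars_bound: "\<exists>n. free_vars \<phi> \<subseteq> {..<n}"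
  using finite_free_vars finite_nat_iff_bounded by blast

lemma well_formed_rename: "well_formed L (rename l \<sigma> \<phi>) \<longleftrightarrow> well_formed L \<phi>"
  by (induction \<phi> arbitrary: l \<sigma>) auto

lemma well_formed_map_params [simp]: "well_formed L (map_params f \<phi>) \<longleftrightarrow> well_formed L \<phi>"
  by (induction \<phi>) auto

lemma trm_vars_map_trm [simp]: "trm_vars (map_trm f t) = trm_vars t"
  by (cases t) auto

lemma free_vars_map_params [simp]: "free_vars (map_params f \<phi>) = free_vars \<phi>"
  by (induction \<phi>) auto

lemma map_params_rename: "map_params f (rename l \<sigma> \<phi>) = rename l (map_trm f \<circ> \<sigma>) \<phi>"
proof (induction \<phi> arbitrary: l \<sigma>)
  case (Exi i \<phi>)
  have "(map_trm f \<circ> \<sigma>)(Var i := Var l) = map_trm f \<circ> (\<sigma>(Var i := Var l))"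
    by (auto simp: fun_eq_iff)
  then show ?case by (simp only: rename.simps formula.map Exi.IH)
qed auto

lemma free_vars_rename:
  assumes "\<And>j. j \<in> free_vars \<phi> \<Longrightarrow> trm_vars (\<sigma> (Var j)) \<subseteq> V"
    and "\<And>c. c \<in> params \<phi> \<Longrightarrow> trm_vars (\<sigma> (Par c)) \<subseteq> V"
  shows "free_vars (rename l \<sigma> \<phi>) \<subseteq> V"
  using assms
proof (induction \<phi> arbitrary: l \<sigma> V)
  case (Rel R ts)
  have "trm_vars (\<sigma> t) \<subseteq> V" if "t \<in> set ts" for t
    using Rel that by (cases t) fastforce+
  then show ?case by auto
next
  case (Eq s t)
  then show ?case by (cases s; cases t) auto
next
  case (Exi i \<phi>)
  have "free_vars (rename (Suc l) (\<sigma>(Var i := Var l)) \<phi>) \<subseteq> insert l V"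
  proof (rule Exi.IH)
    fix j assume "j \<in> free_vars \<phi>"
    then show "trm_vars ((\<sigma>(Var i := Var l)) (Var j)) \<subseteq> insert l V"
      using Exi.prems(1)[of j] by auto
  next
    fix c assume "c \<in> params \<phi>"
    then show "trm_vars ((\<sigma>(Var i := Var l)) (Par c)) \<subseteq> insert l V"
      using Exi.prems(2)[of c] by auto
  qed
  then show ?case by auto
qed (simp_all, blast?)

lemma params_rename:
  assumes "\<And>j. j \<in> free_vars \<phi> \<Longrightarrow> set_trm (\<sigma> (Var j)) \<subseteq> C"
    and "\<And>c. c \<in> params \<phi> \<Longrightarrow> set_trm (\<sigma> (Par c)) \<subseteq> C"
  shows "params (rename l \<sigma> \<phi>) \<subseteq> C"
  using assms
proof (induction \<phi> arbitrary: l \<sigma>)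
  case (Rel R ts)
  have "set_trm (\<sigma> t) \<subseteq> C" if "t \<in> set ts" for t
    using Rel that by (cases t) fastforce+
  then show ?case by auto
next
  case (Eq s t)
  then show ?case by (cases s; cases t) auto
next
  case (Exi i \<phi>)
  have "params (rename (Suc l) (\<sigma>(Var i := Var l)) \<phi>) \<subseteq> C"
  proof (rule Exi.IH)
    fix j assume "j \<in> free_vars \<phi>"
    then show "set_trm ((\<sigma>(Var i := Var l)) (Var j)) \<subseteq> C"
      using Exi.prems(1)[of j] by auto
  next
    fix c assume "c \<in> params \<phi>"
    then show "set_trm ((\<sigma>(Var i := Var l)) (Par c)) \<subseteq> C"
      using Exi.prems(2)[of c] by auto
  qed
  then show ?case by auto
qed (simp_all, blast?)

section \<open>Semantics\<close>

lemma sat_cong: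
  assumes "\<And>j. j \<in> free_vars \<phi> \<Longrightarrow> e j = e' j"
  shows "sat M e \<phi> \<longleftrightarrow> sat M e' \<phi>"
  using assms
proof (induction \<phi> arbitrary: e e')
  case (Rel R ts)
  have "trm_val e t = trm_val e' t" if "t \<in> set ts" for t
    using Rel that by (cases t) fastforce+
  then have "map (trm_val e) ts = map (trm_val e') ts" by simp
  then show ?case by (simp only: sat.simps)
next
  case (Eq s t)
  then show ?case by (cases s; cases t) auto
next
  case (Neg \<phi>)
  show ?case using Neg.IH[of e e'] Neg.prems by simp
next
  case (Conj \<phi> \<psi>)
  show ?case using Conj.IH(1)[of e e'] Conj.IH(2)[of e e'] Conj.prems by simp
next
  case (Exi i \<phi>)
  have "sat M (e(i := a)) \<phi> = sat M (e'(i := a)) \<phi>" for a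
    by (rule Exi.IH) (use Exi.prems in auto)
  then show ?case by simp
qed

text \<open>Here \<open>l\<close> exceeds every variable in the range of \<open>\<sigma>\<close>, so that the bound variables
  \<open>l, l + 1, \<dots>\<close> of the renamed formula capture nothing.\<close>

lemma sat_rename:
  assumes "\<And>j. j \<in> free_vars \<phi> \<Longrightarrow>
      trm_val e (map_trm h (\<sigma> (Var j))) = e' j \<and> trm_vars (\<sigma> (Var j)) \<subseteq> {..<l}"
    and "\<And>c. c \<in> params \<phi> \<Longrightarrow>
      trm_val e (map_trm h (\<sigma> (Par c))) = h' c \<and> trm_vars (\<sigma> (Par c)) \<subseteq> {..<l}"
  shows "sat N e (map_params h (rename l \<sigma> \<phi>)) \<longleftrightarrow> sat N e' (map_params h' \<phi>)"
  using assms
proof (induction \<phi> arbitrary: l \<sigma> e e')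
  case (Rel R ts)
  have "trm_val e (map_trm h (\<sigma> t)) = trm_val e' (map_trm h' t)" if "t \<in> set ts" for t
    using Rel that by (cases t) fastforce+
  then have "map (trm_val e) (map (map_trm h) (map \<sigma> ts))
      = map (trm_val e') (map (map_trm h') ts)" by simp
  then show ?case by (simp only: sat.simps rename.simps formula.map)
next
  case (Eq s t)
  then show ?case by (cases s; cases t) auto
next
  case (Neg \<phi>)
  show ?case using Neg.IH[of e \<sigma> e' l] Neg.prems by simp
next
  case (Conj \<phi> \<psi>)
  show ?case using Conj.IH(1)[of e \<sigma> e' l] Conj.IH(2)[of e \<sigma> e' l] Conj.prems by simp
next
  case (Exi i \<phi>)
  \<comment> \<open>Substituted terms only have variables below \<open>l\<close>, so giving a value
    to the new bound variable \<open>l\<close> does not affect them.\<close>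
  have shift: "trm_val (e(l := a)) (map_trm h t) = trm_val e (map_trm h t)"
    if "trm_vars t \<subseteq> {..<l}" for a t
    using that by (cases t) auto
  have "sat N (e(l := a)) (map_params h (rename (Suc l) (\<sigma>(Var i := Var l)) \<phi>))
      = sat N (e'(i := a)) (map_params h' \<phi>)" for a
  proof (rule Exi.IH, goal_cases)
    case (1 j)
    show ?case
    proof (cases "j = i")
      case False
      then have *: "trm_val e (map_trm h (\<sigma> (Var j))) = e' j" "trm_vars (\<sigma> (Var j)) \<subseteq> {..<l}"
        using Exi.prems(1)[of j] 1 by auto
      have "(\<sigma>(Var i := Var l)) (Var j) = \<sigma> (Var j)" "(e'(i := a)) j = e' j"
        "trm_vars (\<sigma> (Var j)) \<subseteq> {..<Suc l}"
        using False *(2) by auto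
      then show ?thesis using shift[OF *(2)] *(1) by metis
    qed simp
  next
    case (2 c)
    then have *: "trm_val e (map_trm h (\<sigma> (Par c))) = h' c" "trm_vars (\<sigma> (Par c)) \<subseteq> {..<l}"
      using Exi.prems(2)[of c] by auto
    have "(\<sigma>(Var i := Var l)) (Par c) = \<sigma> (Par c)" "trm_vars (\<sigma> (Par c)) \<subseteq> {..<Suc l}"
      using *(2) by auto
    then show ?case using shift[OF *(2)] *(1) by metis
  qed
  then show ?case by simp
qed

lemma embedding_mem_interp:
  assumes "embedding L f A B" "R \<in> symbols L" "xs \<in> lists (universe A)" "length xs = arity L R"
  shows "map f xs \<in> interp B R \<longleftrightarrow> xs \<in> interp A R"
  using assms unfolding embedding_def by blast

lemma sat_isomorphism:
  assumes "isomorphism L g M M'" "well_formed L \<phi>" "params \<phi> \<subseteq> universe M"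
    "\<And>j. j \<in> free_vars \<phi> \<Longrightarrow> e j \<in> universe M"
  shows "sat M' (\<lambda>j. g (e j)) (map_params g \<phi>) \<longleftrightarrow> sat M e \<phi>"
  using assms(2-)
proof (induction \<phi> arbitrary: e)
  case (Rel R ts)
  have "trm_val (\<lambda>j. g (e j)) (map_trm g t) = g (trm_val e t)" for t by (cases t) auto
  then have "map (trm_val (\<lambda>j. g (e j))) (map (map_trm g) ts) = map g (map (trm_val e) ts)" by simp
  moreover have "trm_val e t \<in> universe M" if "t \<in> set ts" for t
  proof (cases t)
    case (Var j)
    then have "j \<in> free_vars (Rel R ts)" using that by force
    then show ?thesis using Rel.prems(3) Var by simp
  next
    case (Par c)
    then have "c \<in> params (Rel R ts)" using that by force
    then show ?thesis using Rel.prems(2) Par by auto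
  qed
  then have "map (trm_val e) ts \<in> lists (universe M)" by auto
  ultimately show ?case
    using embedding_mem_interp[of L g M M' R "map (trm_val e) ts"] assms(1) Rel.prems
    by (simp only: sat.simps formula.map isomorphism_def) simp
next
  case (Eq s t)
  have "trm_val (\<lambda>j. g (e j)) (map_trm g t) = g (trm_val e t)" for t by (cases t) auto
  moreover have "trm_val e s \<in> universe M" "trm_val e t \<in> universe M"
    using Eq.prems(2,3) by (cases s; cases t; auto)+
  ultimately show ?case
    using assms(1) unfolding isomorphism_def embedding_def by (auto simp: inj_on_eq_iff)
next
  case (Neg \<phi>)
  show ?case using Neg.IH[of e] Neg.prems by simp
next
  case (Conj \<phi> \<psi>)
  show ?case using Conj.IH(1)[of e] Conj.IH(2)[of e] Conj.prems by simp
next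
  case (Exi i \<phi>)
  have *: "sat M' ((\<lambda>j. g (e j))(i := g a)) (map_params g \<phi>) = sat M (e(i := a)) \<phi>"
    if "a \<in> universe M" for a
  proof -
    have "(\<lambda>j. g (e j))(i := g a) = (\<lambda>j. g ((e(i := a)) j))" by auto
    moreover have "sat M' (\<lambda>j. g ((e(i := a)) j)) (map_params g \<phi>) = sat M (e(i := a)) \<phi>"
      by (rule Exi.IH) (use Exi.prems that in auto)
    ultimately show ?thesis by simp
  qed
  \<comment> \<open>Surjectivity enters here: every possible witness in \<open>M'\<close> is the
    image of an element of \<open>M\<close>.\<close>
  have "universe M' = g ` universe M" using assms(1) unfolding isomorphism_def by simp
  then show ?case using * by simp
qed

text \<open>Expresses inside the language that some \<open>n\<close>-tuple satisfies
  \<open>\<phi>\<close>, which is what an elementary embedding can transfer. The quantifier over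
  \<open>x_0\<close> is outermost, so that a list of witnesses grows at its right end.\<close>

primrec Exis :: "nat \<Rightarrow> ('r, 'c) formula \<Rightarrow> ('r, 'c) formula" where
  "Exis 0 \<phi> = \<phi>"
| "Exis (Suc n) \<phi> = Exis n (Exi n \<phi>)"

lemma well_formed_Exis [simp]: "well_formed L (Exis n \<phi>) \<longleftrightarrow> well_formed L \<phi>"
  by (induction n arbitrary: \<phi>) auto

lemma params_Exis [simp]: "params (Exis n \<phi>) = params \<phi>"
  by (induction n arbitrary: \<phi>) auto

lemma map_params_Exis [simp]: "map_params h (Exis n \<phi>) = Exis n (map_params h \<phi>)"
  by (induction n arbitrary: \<phi>) auto

lemma sat_Exis:
  "sat M e (Exis n \<phi>) \<longleftrightarrow>
    (\<exists>xs\<in>lists (universe M). length xs = n \<and> sat M (\<lambda>j. if j < n then xs ! j else e j) \<phi>)"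
proof (induction n arbitrary: \<phi>)
  case 0
  then show ?case by auto
next
  case (Suc n)
  have upd: "(\<lambda>j. if j < n then xs ! j else e j)(n := a)
      = (\<lambda>j. if j < Suc n then (xs @ [a]) ! j else e j)" if "length xs = n" for xs a
    using that by (auto simp: fun_eq_iff nth_append)
  have "sat M e (Exis (Suc n) \<phi>) \<longleftrightarrow> (\<exists>xs\<in>lists (universe M). length xs = n \<and>
      (\<exists>a\<in>universe M. sat M (\<lambda>j. if j < Suc n then (xs @ [a]) ! j else e j) \<phi>))"
    using upd by (simp add: Suc cong: conj_cong)
  also have "\<dots> \<longleftrightarrow> (\<exists>ys\<in>lists (universe M). length ys = Suc n \<and>
      sat M (\<lambda>j. if j < Suc n then ys ! j else e j) \<phi>)" (is "?l \<longleftrightarrow> ?r")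
  proof
    assume ?l
    then obtain xs a where "xs \<in> lists (universe M)" "length xs = n" "a \<in> universe M"
      "sat M (\<lambda>j. if j < Suc n then (xs @ [a]) ! j else e j) \<phi>" by blast
    then show ?r by (intro bexI[of _ "xs @ [a]"]) auto
  next
    assume ?r
    then obtain ys where ys: "ys \<in> lists (universe M)" "length ys = Suc n"
      "sat M (\<lambda>j. if j < Suc n then ys ! j else e j) \<phi>" by blast
    obtain xs a where "ys = xs @ [a]" using ys(2) by (metis length_Suc_conv_rev)
    then show ?l using ys by (intro bexI[of _ xs]) auto
  qed
  finally show ?case .
qed

text \<open>The syntax has no constant for truth, so the empty conjunction is a sentence that holds
  in every non-empty structure; hence the assumption on \<open>universe N\<close> in the lemmas on
  satisfaction.\<close>

primrec Conjs :: "('r, 'c) formula list \<Rightarrow> ('r, 'c) formula" where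
  "Conjs [] = Exi 0 (Eq (Var 0) (Var 0))"
| "Conjs (\<phi> # \<phi>s) = Conj \<phi> (Conjs \<phi>s)"

lemma Conjs_mem_formulae: "set \<phi>s \<subseteq> formulae L C n \<Longrightarrow> Conjs \<phi>s \<in> formulae L C n"
  by (induction \<phi>s) (simp_all add: formulae_def)

lemma sat_map_params_Conjs:
  "universe N \<noteq> {} \<Longrightarrow>
    sat N e (map_params h (Conjs \<phi>s)) \<longleftrightarrow> (\<forall>\<phi>\<in>set \<phi>s. sat N e (map_params h \<phi>))"
  by (induction \<phi>s) auto

lemma sat_Conjs: "universe N \<noteq> {} \<Longrightarrow> sat N e (Conjs \<phi>s) \<longleftrightarrow> (\<forall>\<phi>\<in>set \<phi>s. sat N e \<phi>)"
  using sat_map_params_Conjs[of N e "\<lambda>x. x"] by (simp add: formula.map_ident)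

text \<open>\<open>generalise n ms \<phi>\<close> replaces the parameter \<open>ms ! i\<close> by the variable \<open>x\<^sub>n\<^sub>+\<^sub>i\<close>, and
  \<open>instantiate n as \<phi>\<close> replaces \<open>x\<^sub>n\<^sub>+\<^sub>i\<close> by the parameter \<open>as ! i\<close>. Since the results are
  parameter-free resp. arise from parameter-free formulae, the type of the parameters may
  change.\<close>

definition generalise :: "nat \<Rightarrow> 'c list \<Rightarrow> ('r, 'c) formula \<Rightarrow> ('r, 'd) formula" where
  "generalise n ms = rename (n + length ms)
    (\<lambda>t. case t of Var j \<Rightarrow> Var j | Par c \<Rightarrow> Var (n + (SOME i. i < length ms \<and> ms ! i = c)))"

definition instantiate :: "nat \<Rightarrow> 'd list \<Rightarrow> ('r, 'c) formula \<Rightarrow> ('r, 'd) formula" where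
  "instantiate n as = rename n
    (\<lambda>t. case t of Var j \<Rightarrow> if n \<le> j \<and> j < n + length as then Par (as ! (j - n)) else Var j
      | Par c \<Rightarrow> Var 0)"

lemma generalise_index:
  assumes "c \<in> set ms"
  shows "(SOME i. i < length ms \<and> ms ! i = c) < length ms"
    "ms ! (SOME i. i < length ms \<and> ms ! i = c) = c"
proof -
  have "\<exists>i. i < length ms \<and> ms ! i = c" using assms by (simp add: in_set_conv_nth)
  from someI_ex[OF this] show "(SOME i. i < length ms \<and> ms ! i = c) < length ms"
    "ms ! (SOME i. i < length ms \<and> ms ! i = c) = c" by simp_all
qed

lemma generalise_mem_formulae:
  assumes "\<phi> \<in> formulae L (set ms) n"
  shows "generalise n ms \<phi> \<in> formulae L {} (n + length ms)"
  unfolding formulae_def generalise_def mem_Collect_eq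
proof (intro conjI free_vars_rename params_rename, goal_cases)
  case (5 c)
  then have "c \<in> set ms" using assms by (auto simp: formulae_def)
  then show ?case using generalise_index(1)[of c ms] by simp
qed (use assms in \<open>auto simp: formulae_def well_formed_rename\<close>)

text \<open>The formula on the left does not depend on \<open>f\<close>: one parameter-free formula,
  evaluated at the images of \<open>ms\<close> under varying maps, decides all translates of
  \<open>\<phi>\<close>. This is what makes the truth value of \<open>\<phi>\<close> an externally
  definable colouring.\<close>

lemma sat_generalise:
  assumes \<phi>: "\<phi> \<in> formulae L (set ms) n" and es: "length es = n" "length ys = length ms"
    and f: "\<And>i. i < length ms \<Longrightarrow> f (ms ! i) = ys ! i"
  shows "sat_tuple N (es @ ys) (generalise n ms \<phi>) \<longleftrightarrow> sat_tuple N es (map_params f \<phi>)"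
proof -
  have "sat_tuple N (es @ ys) (map_params (\<lambda>x. x) (generalise n ms \<phi>))
      \<longleftrightarrow> sat_tuple N es (map_params f \<phi>)"
    unfolding generalise_def
  proof (rule sat_rename, goal_cases)
    case (1 j)
    then have "j < n" using \<phi> by (auto simp: formulae_def)
    then show ?case using es by (simp add: nth_append)
  next
    case (2 c)
    then have "c \<in> set ms" using \<phi> by (auto simp: formulae_def)
    from generalise_index[OF this] show ?case
      using f[of "SOME i. i < length ms \<and> ms ! i = c"] es by (simp add: nth_append)
  qed
  then show ?thesis by (simp add: formula.map_ident)
qed

lemma instantiate_mem_formulae:
  assumes "\<phi> \<in> formulae L {} (n + length as)" "set as \<subseteq> C"
  shows "instantiate n as \<phi> \<in> formulae L C n"
  unfolding formulae_def instantiate_def mem_Collect_eq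
proof (intro conjI free_vars_rename params_rename, goal_cases)
  case (4 j)
  then have "j < n + length as" using assms by (auto simp: formulae_def)
  then show ?case by (simp add: not_le)
next
  case (2 j)
  show ?case
  proof (cases "n \<le> j \<and> j < n + length as")
    case True
    then have "as ! (j - n) \<in> set as" by (intro nth_mem) auto
    then show ?thesis using assms(2) True by auto
  qed auto
qed (use assms in \<open>auto simp: formulae_def well_formed_rename\<close>)

text \<open>Maps act on instantiated formulae by moving the tuple, since no other parameters occur
  in them.\<close>

lemma map_params_instantiate:
  "map_params g (instantiate n as \<phi>) = instantiate n (map g as) \<phi>"
  unfolding instantiate_def map_params_rename
  by (rule arg_cong[where f = "\<lambda>\<sigma>. rename n \<sigma> \<phi>"]) (auto simp: fun_eq_iff split: trm.split)

text \<open>\<open>e\<close> has to agree with \<open>es\<close> only below \<open>n\<close>, so the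
  tuple may have been lengthened by further elements.\<close>

lemma sat_instantiate:
  assumes \<phi>: "\<phi> \<in> formulae L {} (n + length as)" and es: "length es = n" "\<And>j. j < n \<Longrightarrow> e j = es ! j"
  shows "sat N e (map_params h (instantiate n as \<phi>)) \<longleftrightarrow> sat_tuple N (es @ map h as) \<phi>"
proof -
  have "sat N e (map_params h (instantiate n as \<phi>))
      \<longleftrightarrow> sat_tuple N (es @ map h as) (map_params (\<lambda>x. x) \<phi>)"
    unfolding instantiate_def
  proof (rule sat_rename, goal_cases)
    case (1 j)
    then have "j < n + length as" using \<phi> by (auto simp: formulae_def)
    then show ?case using es by (auto simp: nth_append not_le)
  qed (use \<phi> in \<open>simp add: formulae_def\<close>)
  then show ?thesis by (simp add: formula.map_ident)
qed

text \<open>The definition of an elementary embedding only speaks about parameter-free formulae.\<close>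

lemma elementary_embedding_params:
  assumes h: "elementary_embedding L h M N"
    and \<phi>: "\<phi> \<in> formulae L (universe M) n"
    and xs: "xs \<in> lists (universe M)" "length xs = n"
  shows "sat_tuple N (map h xs) (map_params h \<phi>) \<longleftrightarrow> sat_tuple M xs \<phi>"
proof -
  obtain ms where ms: "set ms = params \<phi>"
    using finite_distinct_list[OF finite_params[of \<phi>]] by auto
  have \<phi>': "\<phi> \<in> formulae L (set ms) n" using \<phi> ms by (simp add: formulae_def)
  have "set ms \<subseteq> universe M" using ms \<phi> by (simp add: formulae_def)
  then have "xs @ ms \<in> lists (universe M)" "length (xs @ ms) = n + length ms"
    using xs by auto
  then have *: "sat_tuple M (xs @ ms) (generalise n ms \<phi>)
      \<longleftrightarrow> sat_tuple N (map h (xs @ ms)) (map_params h (generalise n ms \<phi>))"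
    using h generalise_mem_formulae[OF \<phi>'] unfolding elementary_embedding_def by blast
  \<comment> \<open>The two occurrences of \<open>generalise\<close> have different parameter types.
    The substitution yields variables only, so \<open>h\<close> merely changes the type.\<close>
  have "map_params h (generalise n ms \<phi>) = generalise n ms \<phi>"
    unfolding generalise_def map_params_rename
    by (rule arg_cong[where f = "\<lambda>\<sigma>. rename _ \<sigma> \<phi>"]) (simp add: fun_eq_iff split: trm.split)
  then show ?thesis
    using * sat_generalise[OF \<phi>' xs(2), of ms "\<lambda>x. x" M]
      sat_generalise[OF \<phi>', of "map h xs" "map h ms" h N] xs(2)
    by (simp add: formula.map_ident)
qed

unbundle cardinal_syntax

section \<open>Ultrafilters and cardinality\<close>

text \<open>The second clause combines closure under intersections with closure under supersets.
  Ultrafilters live on a whole type; a smaller index set is imposed by making it a member.\<close>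

definition ultrafilter :: "'x set set \<Rightarrow> bool" where
  "ultrafilter D \<longleftrightarrow> {} \<notin> D \<and> (\<forall>A B. A \<inter> B \<in> D \<longleftrightarrow> A \<in> D \<and> B \<in> D) \<and> (\<forall>A. - A \<in> D \<longleftrightarrow> A \<notin> D)"

lemma ultrafilter_Int: "ultrafilter D \<Longrightarrow> A \<inter> B \<in> D \<longleftrightarrow> A \<in> D \<and> B \<in> D"
  unfolding ultrafilter_def by blast

lemma ultrafilter_Compl: "ultrafilter D \<Longrightarrow> - A \<in> D \<longleftrightarrow> A \<notin> D"
  unfolding ultrafilter_def by blast

lemma ultrafilter_mono: "ultrafilter D \<Longrightarrow> A \<in> D \<Longrightarrow> A \<subseteq> B \<Longrightarrow> B \<in> D"
  using ultrafilter_Int[of D A B] by (simp add: Int_absorb2)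

lemma ultrafilter_UNIV: "ultrafilter D \<Longrightarrow> UNIV \<in> D"
  using ultrafilter_Compl[of D "{}"] by (simp add: ultrafilter_def)

lemma ultrafilter_cong:
  assumes "ultrafilter D" "S \<in> D" "A \<inter> S = B \<inter> S"
  shows "A \<in> D \<longleftrightarrow> B \<in> D"
  using ultrafilter_Int[OF assms(1), of A S] ultrafilter_Int[OF assms(1), of B S] assms(2,3) by simp

lemma ultrafilter_ex_mem: "ultrafilter D \<Longrightarrow> A \<in> D \<Longrightarrow> \<exists>x. x \<in> A"
  unfolding ultrafilter_def by (cases "A = {}") auto

lemma ultrafilter_Inter:
  assumes "ultrafilter D" "finite F" "F \<subseteq> D"
  shows "\<Inter>F \<in> D"
  using assms(2,3) by (induction) (auto simp: ultrafilter_UNIV[OF assms(1)] ultrafilter_Int[OF assms(1)])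

text \<open>By Zorn there is a maximal family with the finite intersection property above
  \<open>B\<close>, because a finite subfamily of the union of a chain lies in one member of the
  chain. Maximality makes it an ultrafilter.\<close>

lemma ultrafilter_exists:
  assumes fip: "\<And>F. finite F \<Longrightarrow> F \<subseteq> B \<Longrightarrow> \<Inter>F \<noteq> {}"
  shows "\<exists>D. ultrafilter D \<and> B \<subseteq> D"
proof -
  define P where "P D \<longleftrightarrow> (\<forall>F. finite F \<and> F \<subseteq> D \<longrightarrow> \<Inter>F \<noteq> {})" for D :: "'a set set"
  have "\<exists>D\<in>{D. B \<subseteq> D \<and> P D}. \<forall>X\<in>{D. B \<subseteq> D \<and> P D}. D \<subseteq> X \<longrightarrow> X = D"
  proof (rule subset_Zorn_nonempty)
    show "{D. B \<subseteq> D \<and> P D} \<noteq> {}" using fip by (auto simp: P_def)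
  next
    fix C assume C: "C \<noteq> {}" "subset.chain {D. B \<subseteq> D \<and> P D} C"
    have "P (\<Union>C)" unfolding P_def
    proof (intro allI impI)
      fix F assume F: "finite F \<and> F \<subseteq> \<Union>C"
      then obtain D where "D \<in> C" "F \<subseteq> D"
        using finite_subset_Union_chain[of F C, OF _ _ C] by auto
      then have "P D" using C(2) unfolding subset_chain_def by auto
      then show "\<Inter>F \<noteq> {}" using F \<open>F \<subseteq> D\<close> unfolding P_def by simp
    qed
    moreover have "B \<subseteq> \<Union>C"
    proof -
      obtain E where "E \<in> C" using C(1) by auto
      moreover from this have "B \<subseteq> E" using C(2) unfolding subset_chain_def by auto
      ultimately show ?thesis by auto
    qed
    ultimately show "\<Union>C \<in> {D. B \<subseteq> D \<and> P D}" by simp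
  qed
  then obtain D where D: "B \<subseteq> D" "P D" and max: "\<And>X. B \<subseteq> X \<Longrightarrow> P X \<Longrightarrow> D \<subseteq> X \<Longrightarrow> X = D"
    by auto
  \<comment> \<open>Maximality in usable form: a set outside \<open>D\<close> cannot be added, so it
    is disjoint from some finite intersection of members. The clauses on intersections and
    complements rest on this.\<close>
  have notin: "\<exists>F. finite F \<and> F \<subseteq> D \<and> A \<inter> \<Inter>F = {}" if "A \<notin> D" for A
  proof -
    have "\<not> P (insert A D)" using max[of "insert A D"] that D(1) by blast
    then obtain F where F: "finite F" "F \<subseteq> insert A D" "\<Inter>F = {}" unfolding P_def by auto
    then have "finite (F - {A})" "F - {A} \<subseteq> D" "A \<inter> \<Inter>(F - {A}) = {}" by auto
    then show ?thesis by (intro exI[of _ "F - {A}"]) simp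
  qed
  have up: "A \<in> D" if F: "finite F" "F \<subseteq> D" "\<Inter>F \<subseteq> A" for F A
  proof (rule ccontr)
    assume "A \<notin> D"
    then obtain F' where F': "finite F'" "F' \<subseteq> D" "A \<inter> \<Inter>F' = {}" using notin[of A] by auto
    then have "\<Inter>(F \<union> F') = {}" using F(3) by (auto simp: Inter_Un_distrib)
    then show False using D(2)[unfolded P_def, rule_format, of "F \<union> F'"] F F' by auto
  qed
  have "{} \<notin> D" using D(2)[unfolded P_def, rule_format, of "{{}}"] by auto
  moreover have "A \<inter> A' \<in> D \<longleftrightarrow> A \<in> D \<and> A' \<in> D" for A A'
  proof
    assume "A \<inter> A' \<in> D"
    then show "A \<in> D \<and> A' \<in> D" by (intro conjI up[of "{A \<inter> A'}"]) simp_all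
  next
    assume "A \<in> D \<and> A' \<in> D"
    then show "A \<inter> A' \<in> D" by (intro up[of "{A, A'}"]) simp_all
  qed
  moreover have "- A \<in> D \<longleftrightarrow> A \<notin> D" for A
  proof
    assume "- A \<in> D"
    then show "A \<notin> D" using D(2)[unfolded P_def, rule_format, of "{A, - A}"] by auto
  next
    assume "A \<notin> D"
    then obtain F where F: "finite F" "F \<subseteq> D" "A \<inter> \<Inter>F = {}" using notin[of A] by auto
    then have "\<Inter>F \<subseteq> - A" by auto
    then show "- A \<in> D" by (rule up[OF F(1,2)])
  qed
  ultimately have "ultrafilter D" unfolding ultrafilter_def by simp
  then show ?thesis using D(1) by auto
qed

section \<open>Cardinal arithmetic below an infinite set \<open>K\<close>\<close>

lemma card_of_image_ordLeq: "|A| \<le>o r \<Longrightarrow> |f ` A| \<le>o r"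
  by (rule ordLeq_transitive[OF card_of_image])

lemma card_of_subset_ordLeq: "A \<subseteq> B \<Longrightarrow> |B| \<le>o r \<Longrightarrow> |A| \<le>o r"
  by (rule ordLeq_transitive[OF card_of_mono1])

lemma card_of_Un_ordLeq_infinite:
  "infinite K \<Longrightarrow> |A| \<le>o |K| \<Longrightarrow> |B| \<le>o |K| \<Longrightarrow> |A \<union> B| \<le>o |K|"
  using card_of_Un_ordLeq_infinite_Field[of "|K|", OF _ _ _ card_of_Card_order] by (simp add: Field_card_of)

lemma card_of_Times_ordLeq_infinite:
  "infinite K \<Longrightarrow> |A| \<le>o |K| \<Longrightarrow> |B| \<le>o |K| \<Longrightarrow> |A \<times> B| \<le>o |K|"
  using card_of_Times_ordLeq_infinite_Field[of "|K|", OF _ _ _ card_of_Card_order] by (simp add: Field_card_of)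

text \<open>Lists of a fixed length are bounded by induction, since products of sets no larger than
  \<open>K\<close> are no larger than \<open>K\<close>; then the countably many lengths are
  united.\<close>

lemma card_of_lists_ordLeq:
  assumes K: "infinite K" and "|A| \<le>o |K|"
  shows "|lists A| \<le>o |K|"
proof -
  have "|{xs \<in> lists A. length xs = n}| \<le>o |K|" for n
  proof (induction n)
    case 0
    have "{xs \<in> lists A. length xs = 0} = {[]}" by auto
    then show ?case using K by (metis card_of_singl_ordLeq finite.emptyI)
  next
    case (Suc n)
    have "{xs \<in> lists A. length xs = Suc n}
        \<subseteq> (\<lambda>(x, xs). x # xs) ` (A \<times> {xs \<in> lists A. length xs = n})"
      by (auto simp: length_Suc_conv)
    then show ?case
      by (rule card_of_subset_ordLeq)
        (intro card_of_image_ordLeq card_of_Times_ordLeq_infinite[OF K assms(2) Suc])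
  qed
  then have "|\<Union>n\<in>(UNIV::nat set). {xs \<in> lists A. length xs = n}| \<le>o |K|"
    by (intro card_of_UNION_ordLeq_infinite[OF K] iffD1[OF infinite_iff_card_of_nat K]) simp
  moreover have "(\<Union>n\<in>(UNIV::nat set). {xs \<in> lists A. length xs = n}) = lists A" by auto
  ultimately show ?thesis by simp
qed

text \<open>The operations take lists of any length, so arities need no bookkeeping. Elements to
  start from are included as operations that ignore their arguments.\<close>

inductive_set closure_under :: "('i \<Rightarrow> 'b list \<Rightarrow> 'b) \<Rightarrow> 'i set \<Rightarrow> 'b set" for f I where
  "i \<in> I \<Longrightarrow> xs \<in> lists (closure_under f I) \<Longrightarrow> f i xs \<in> closure_under f I"
  monos lists_mono

text \<open>Each element is generated in finitely many steps from finite lists of arguments, so the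
  closure lies in the union of the stages \<open>S 0, S 1, ...\<close>, none of which is larger than
  \<open>K\<close>.\<close>

lemma card_of_closure_under:
  assumes K: "infinite K" and I: "|I| \<le>o |K|"
  shows "|closure_under f I| \<le>o |K|"
proof -
  define S where "S = rec_nat {} (\<lambda>_ T. (\<lambda>(i, xs). f i xs) ` (I \<times> lists T))"
  have S_Suc: "S (Suc n) = (\<lambda>(i, xs). f i xs) ` (I \<times> lists (S n))" for n
    by (simp add: S_def)
  have mono: "S n \<subseteq> S (Suc n)" for n
  proof (induction n)
    case 0
    then show ?case by (simp add: S_def)
  next
    case (Suc n)
    then show ?case unfolding S_Suc[of "Suc n"] S_Suc[of n] using lists_mono by fastforce
  qed
  have "x \<in> (\<Union>n. S n)" if "x \<in> closure_under f I" for x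
    using that
  proof induction
    case (1 i xs)
    have "\<exists>n. xs \<in> lists (S n)" using 1(2)
    proof (induction xs)
      case (Cons x xs)
      then obtain m n where mn: "x \<in> S m" "xs \<in> lists (S n)" by auto
      have "S m \<subseteq> S (max m n)" "S n \<subseteq> S (max m n)"
        by (rule lift_Suc_mono_le[of S, OF mono]; simp)+
      then have "x # xs \<in> lists (S (max m n))" using mn lists_mono[of "S n"] by auto
      then show ?case ..
    qed simp
    then show ?case using 1(1) S_Suc by blast
  qed
  then have "closure_under f I \<subseteq> (\<Union>n. S n)" by blast
  moreover have "|S n| \<le>o |K|" for n
  proof (induction n)
    case 0
    then show ?case by (simp add: S_def card_of_empty)
  next
    case (Suc n)
    have "|I \<times> lists (S n)| \<le>o |K|"
      by (rule card_of_Times_ordLeq_infinite[OF K I card_of_lists_ordLeq[OF K Suc]])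
    then show ?case unfolding S_Suc by (rule card_of_image_ordLeq)
  qed
  then have "|\<Union>n. S n| \<le>o |K|"
    by (intro card_of_UNION_ordLeq_infinite[OF K] iffD1[OF infinite_iff_card_of_nat K]) simp
  ultimately show ?thesis by (rule card_of_subset_ordLeq)
qed

text \<open>Formulae are generated from the atomic ones by finitary operations. The bound serves to
  count the Skolem functions of the hull.\<close>

lemma card_of_formulae:
  fixes L :: "'r language" and C :: "'c set"
  assumes K: "infinite K" and L: "countable (symbols L)" and C: "|C| \<le>o |K|"
  shows "|{\<phi> :: ('r, 'c) formula. well_formed L \<phi> \<and> params \<phi> \<subseteq> C}| \<le>o |K|"
proof -
  have nat: "|UNIV :: nat set| \<le>o |K|" by (rule iffD1[OF infinite_iff_card_of_nat K])
  define T where "T = range Var \<union> Par ` C"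
  have T: "|T| \<le>o |K|" unfolding T_def
    by (intro card_of_Un_ordLeq_infinite card_of_image_ordLeq K nat C)
  define At :: "('r, 'c) formula set"
    where "At = (\<lambda>(R, ts). Rel R ts) ` (symbols L \<times> lists T) \<union> (\<lambda>(s, t). Eq s t) ` (T \<times> T)"
  have "|symbols L| \<le>o |K|"
    proof (rule ordLeq_transitive[OF _ nat])
    show "|symbols L| \<le>o |UNIV :: nat set|"
      using L card_of_ordLeq[of "symbols L" "UNIV :: nat set"] unfolding countable_def by simp
  qed
  then have At: "|At| \<le>o |K|" unfolding At_def
    by (intro card_of_Un_ordLeq_infinite card_of_image_ordLeq card_of_Times_ordLeq_infinite
        card_of_lists_ordLeq K T)
  \<comment> \<open>Atomic formulae enter as constant operations. The numbers code the others: 0 is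
    negation, 1 is conjunction, and \<open>k + 2\<close> is quantification over \<open>x_k\<close>.
    Lists that are too short may produce further formulae through \<open>hd []\<close>, which is
    harmless for an upper bound.\<close>
  define I where "I = Inl ` At \<union> range (Inr :: nat \<Rightarrow> _)"
  define f where "f i xs = (case i of Inl \<phi> \<Rightarrow> \<phi>
    | Inr 0 \<Rightarrow> Neg (hd xs) | Inr (Suc 0) \<Rightarrow> Conj (hd xs) (hd (tl xs)) | Inr (Suc (Suc k)) \<Rightarrow> Exi k (hd xs))"
    for i and xs :: "('r, 'c) formula list"
  have "|I| \<le>o |K|" unfolding I_def
    by (intro card_of_Un_ordLeq_infinite card_of_image_ordLeq K At nat)
  have f: "f (Inl \<phi>) xs = \<phi>" "f (Inr 0) xs = Neg (hd xs)"
    "f (Inr (Suc 0)) xs = Conj (hd xs) (hd (tl xs))" "f (Inr (Suc (Suc k))) xs = Exi k (hd xs)"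
    for \<phi> xs k by (simp_all add: f_def)
  have step: "set xs \<subseteq> closure_under f I \<Longrightarrow> i \<in> I \<Longrightarrow> f i xs \<in> closure_under f I" for i xs
    by (rule closure_under.intros) auto
  have "\<phi> \<in> closure_under f I" if "well_formed L \<phi>" "params \<phi> \<subseteq> C" for \<phi>
    using that
  proof (induction \<phi>)
    case (Rel R ts)
    have "t \<in> T" if "t \<in> set ts" for t
    proof -
      have "set_trm t \<subseteq> C" using Rel.prems(2) that by auto
      then show ?thesis by (cases t) (auto simp: T_def)
    qed
    then have "Rel R ts \<in> At" using Rel by (auto simp: At_def)
    then show ?case using step[of "[]" "Inl (Rel R ts)", unfolded f] by (simp add: I_def f)
  next
    case (Eq s t)
    then have "Eq s t \<in> At" by (cases s; cases t) (auto simp: At_def T_def)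
    then show ?case using step[of "[]" "Inl (Eq s t)", unfolded f] by (simp add: I_def f)
  next
    case (Neg \<phi>)
    then show ?case using step[of "[\<phi>]" "Inr 0", unfolded f] by (simp add: I_def f)
  next
    case (Conj \<phi> \<psi>)
    then show ?case using step[of "[\<phi>, \<psi>]" "Inr (Suc 0)", unfolded f] by (simp add: I_def f)
  next
    case (Exi i \<phi>)
    then show ?case using step[of "[\<phi>]" "Inr (Suc (Suc i))", unfolded f] by (simp add: I_def f)
  qed
  then have "{\<phi>. well_formed L \<phi> \<and> params \<phi> \<subseteq> C} \<subseteq> closure_under f I" by blast
  then show ?thesis
    by (rule card_of_subset_ordLeq[OF _ card_of_closure_under[OF K \<open>|I| \<le>o |K|\<close>]])
qed

section \<open>Types\<close>

lemma types_subset: "p \<in> types L M n \<Longrightarrow> p \<subseteq> formulae L (universe M) n"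
  unfolding types_def by simp

lemma types_finitely_satisfiable:
  "p \<in> types L M n \<Longrightarrow> finite F \<Longrightarrow> F \<subseteq> p \<Longrightarrow>
    \<exists>xs\<in>lists (universe M). length xs = n \<and> (\<forall>\<phi>\<in>F. sat_tuple M xs \<phi>)"
  unfolding types_def by simp

lemma Neg_mem_formulae: "Neg \<phi> \<in> formulae L C n \<longleftrightarrow> \<phi> \<in> formulae L C n"
  unfolding formulae_def by simp

lemma types_Neg:
  assumes "p \<in> types L M n" "\<phi> \<in> formulae L (universe M) n"
  shows "Neg \<phi> \<in> p \<longleftrightarrow> \<phi> \<notin> p"
proof -
  have "\<phi> \<in> p \<or> Neg \<phi> \<in> p" using assms unfolding types_def by simp
  moreover have "\<not> (\<phi> \<in> p \<and> Neg \<phi> \<in> p)"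
    using types_finitely_satisfiable[OF assms(1), of "{\<phi>, Neg \<phi>}"] by auto
  ultimately show ?thesis by auto
qed

lemma types_eqI:
  assumes "p \<in> types L M n" "q \<in> types L M n" "p \<subseteq> q"
  shows "p = q"
proof -
  have "\<phi> \<in> p" if "\<phi> \<in> q" for \<phi>
    using that assms types_subset[OF assms(2)] types_Neg[OF assms(1), of \<phi>] types_Neg[OF assms(2), of \<phi>]
    by auto
  then show ?thesis using assms(3) by auto
qed

text \<open>The generating sets are conditions on single formulae, so finite intersections of them
  are conditions on finite sets \<open>F\<close>. This reduces closedness to statements about finite
  parts of types.\<close>

lemma openin_Stone_space:
  "openin (Stone_space L M n) U \<longleftrightarrow> U \<subseteq> types L M n \<and>
    (\<forall>p\<in>U. \<exists>F\<subseteq>p. finite F \<and> (\<forall>q\<in>types L M n. F \<subseteq> q \<longrightarrow> q \<in> U))"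
  (is "_ \<longleftrightarrow> ?B U")
proof
  assume "openin (Stone_space L M n) U"
  then have "generate_topology_on ((\<lambda>\<phi>. {p \<in> types L M n. \<phi> \<in> p}) ` formulae L (universe M) n) U"
    unfolding Stone_space_def openin_topology_generated_by_iff .
  then show "?B U"
  proof induction
    case Empty
    then show ?case by simp
  next
    case (Int a b)
    show ?case
    proof (intro conjI ballI)
      show "a \<inter> b \<subseteq> types L M n" using Int by auto
      fix p assume p: "p \<in> a \<inter> b"
      then obtain F where F: "F \<subseteq> p" "finite F" "\<forall>q\<in>types L M n. F \<subseteq> q \<longrightarrow> q \<in> a"
        using bspec[OF conjunct2[OF Int.IH(1)], of p] by auto
      obtain F' where F': "F' \<subseteq> p" "finite F'" "\<forall>q\<in>types L M n. F' \<subseteq> q \<longrightarrow> q \<in> b"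
        using bspec[OF conjunct2[OF Int.IH(2)], of p] p by auto
      show "\<exists>F\<subseteq>p. finite F \<and> (\<forall>q\<in>types L M n. F \<subseteq> q \<longrightarrow> q \<in> a \<inter> b)"
        by (rule exI[of _ "F \<union> F'"]) (use F F' in auto)
    qed
  next
    case (UN K)
    show ?case
    proof (intro conjI ballI)
      show "\<Union>K \<subseteq> types L M n" using UN.IH by auto
      fix p assume "p \<in> \<Union>K"
      then obtain k where k: "k \<in> K" "p \<in> k" by auto
      then obtain F where F: "F \<subseteq> p" "finite F" "\<forall>q\<in>types L M n. F \<subseteq> q \<longrightarrow> q \<in> k"
        using bspec[OF conjunct2[OF UN.IH[OF k(1)]] k(2)] by (elim exE conjE)
      then show "\<exists>F\<subseteq>p. finite F \<and> (\<forall>q\<in>types L M n. F \<subseteq> q \<longrightarrow> q \<in> \<Union>K)"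
        using k(1) by (intro exI[of _ F]) (auto intro: UnionI)
    qed
  next
    case (Basis s)
    then obtain \<phi> where \<phi>: "s = {p \<in> types L M n. \<phi> \<in> p}" by auto
    show ?case
    proof (intro conjI ballI)
      show "s \<subseteq> types L M n" using \<phi> by auto
      fix p assume "p \<in> s"
      then show "\<exists>F\<subseteq>p. finite F \<and> (\<forall>q\<in>types L M n. F \<subseteq> q \<longrightarrow> q \<in> s)"
        using \<phi> by (intro exI[of _ "{\<phi>}"]) simp
    qed
  qed
next
  assume U: "?B U"
  have basic: "openin (Stone_space L M n) {q \<in> types L M n. F \<subseteq> q}"
    if "finite F" "F \<subseteq> formulae L (universe M) n" for F
    using that
  proof (induction F)
    case empty
    then show ?case using openin_topspace[of "Stone_space L M n"] by (simp add: topspace_Stone_space)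
  next
    case (insert \<phi> F)
    have "openin (Stone_space L M n) {p \<in> types L M n. \<phi> \<in> p}"
      unfolding Stone_space_def by (rule topology_generated_by_Basis) (use insert.prems in auto)
    then have "openin (Stone_space L M n)
        ({p \<in> types L M n. \<phi> \<in> p} \<inter> {q \<in> types L M n. F \<subseteq> q})"
      using insert by (intro openin_Int) auto
    moreover have "{p \<in> types L M n. \<phi> \<in> p} \<inter> {q \<in> types L M n. F \<subseteq> q}
        = {q \<in> types L M n. insert \<phi> F \<subseteq> q}" by auto
    ultimately show ?case by simp
  qed
  have "\<exists>T. openin (Stone_space L M n) T \<and> p \<in> T \<and> T \<subseteq> U" if p: "p \<in> U" for p
  proof -
    obtain F where F: "F \<subseteq> p" "finite F" "\<forall>q\<in>types L M n. F \<subseteq> q \<longrightarrow> q \<in> U"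
      using bspec[OF conjunct2[OF U] p] by auto
    have pt: "p \<in> types L M n" using U p by auto
    then have "F \<subseteq> formulae L (universe M) n" using F(1) types_subset by blast
    then show ?thesis
      using basic[OF F(2)] F pt by (intro exI[of _ "{q \<in> types L M n. F \<subseteq> q}"]) auto
  qed
  then show "openin (Stone_space L M n) U" using openin_subopen[of "Stone_space L M n" U] by simp
qed

lemma closedin_Stone_spaceI:
  assumes "C \<subseteq> types L M n"
    "\<And>p. p \<in> types L M n \<Longrightarrow> p \<notin> C \<Longrightarrow>
      \<exists>F\<subseteq>p. finite F \<and> (\<forall>q\<in>types L M n. F \<subseteq> q \<longrightarrow> q \<notin> C)"
  shows "closedin (Stone_space L M n) C"
  unfolding closedin_def topspace_Stone_space openin_Stone_space
proof (intro conjI ballI)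
  fix p assume "p \<in> types L M n - C"
  then obtain F where "F \<subseteq> p" "finite F" "\<forall>q\<in>types L M n. F \<subseteq> q \<longrightarrow> q \<notin> C"
    using assms(2)[of p] by (elim DiffE) metis
  then show "\<exists>F\<subseteq>p. finite F \<and> (\<forall>q\<in>types L M n. F \<subseteq> q \<longrightarrow> q \<in> types L M n - C)"
    by (intro exI[of _ F]) simp
qed (use assms(1) in auto)

lemma closedin_Stone_spaceD:
  assumes "closedin (Stone_space L M n) C" "p \<in> types L M n" "p \<notin> C"
  shows "\<exists>F\<subseteq>p. finite F \<and> (\<forall>q\<in>types L M n. F \<subseteq> q \<longrightarrow> q \<notin> C)"
proof -
  have "\<forall>p\<in>types L M n - C. \<exists>F\<subseteq>p. finite F \<and>
      (\<forall>q\<in>types L M n. F \<subseteq> q \<longrightarrow> q \<in> types L M n - C)"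
    using assms(1) unfolding closedin_def topspace_Stone_space openin_Stone_space by (elim conjE)
  then obtain F where "F \<subseteq> p" "finite F" "\<forall>q\<in>types L M n. F \<subseteq> q \<longrightarrow> q \<in> types L M n - C"
    using assms(2,3) by (metis DiffI)
  then show ?thesis by (intro exI[of _ F]) simp
qed

text \<open>An ultrafilter containing every set of the family has a limit type, and closed sets of
  the ultrafilter contain the limit.\<close>

lemma compact_space_Stone_space: "compact_space (Stone_space L M n)"
  unfolding compact_space_fip
proof (intro allI impI, elim conjE)
  fix \<U> assume closed: "\<forall>C\<in>\<U>. closedin (Stone_space L M n) C"
    and fip: "\<forall>\<F>. finite \<F> \<and> \<F> \<subseteq> \<U> \<longrightarrow> \<Inter>\<F> \<noteq> {}"
  show "\<Inter>\<U> \<noteq> {}"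
  proof (cases "\<U> = {}")
    case False
    obtain D where D: "ultrafilter D" "\<U> \<subseteq> D"
      using ultrafilter_exists[of \<U>] fip by auto
    obtain C0 where "C0 \<in> \<U>" using False by auto
    \<comment> \<open>This is why the empty family is treated separately: a member of
      \<open>\<U>\<close> guarantees that almost every point is a type.\<close>
    have "types L M n \<in> D"
    proof (rule ultrafilter_mono[OF D(1), of C0])
      show "C0 \<in> D" using D(2) \<open>C0 \<in> \<U>\<close> by auto
      show "C0 \<subseteq> types L M n"
        using closedin_subset[of "Stone_space L M n" C0] closed \<open>C0 \<in> \<U>\<close> by (simp add: topspace_Stone_space)
    qed
    \<comment> \<open>The limit of \<open>D\<close>: the formulae contained in almost every
      type.\<close>
    define p where "p = {\<phi> \<in> formulae L (universe M) n. {q. \<phi> \<in> q} \<in> D}"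
    \<comment> \<open>With \<open>A = types L M n\<close> this gives finite satisfiability of
      \<open>p\<close>; with \<open>A = C\<close> it shows that no finite part of \<open>p\<close>
      separates \<open>p\<close> from \<open>C\<close>.\<close>
    have ex: "\<exists>q. q \<in> types L M n \<and> F \<subseteq> q \<and> q \<in> A" if "finite F" "F \<subseteq> p" "A \<in> D" for F A
    proof -
      have "\<Inter>((\<lambda>\<phi>. {q. \<phi> \<in> q}) ` F) \<in> D"
        by (rule ultrafilter_Inter[OF D(1)]) (use that in \<open>auto simp: p_def\<close>)
      then have "\<Inter>((\<lambda>\<phi>. {q. \<phi> \<in> q}) ` F) \<inter> (types L M n \<inter> A) \<in> D"
        using that(3) \<open>types L M n \<in> D\<close> ultrafilter_Int[OF D(1)] by simp
      from ultrafilter_ex_mem[OF D(1) this] show ?thesis by auto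
    qed
    have p: "p \<in> types L M n"
      unfolding types_def mem_Collect_eq
    proof (intro conjI allI impI ballI)
      show "p \<subseteq> formulae L (universe M) n" by (auto simp: p_def)
    next
      fix F assume F: "F \<subseteq> p" "finite F"
      then obtain q where "q \<in> types L M n" "F \<subseteq> q" using ex[OF F(2,1) \<open>types L M n \<in> D\<close>] by auto
      then show "\<exists>xs\<in>lists (universe M). length xs = n \<and> (\<forall>\<phi>\<in>F. sat_tuple M xs \<phi>)"
        using types_finitely_satisfiable[of q L M n F] F(2) by simp
    next
      fix \<phi> assume \<phi>: "\<phi> \<in> formulae L (universe M) n"
      have "{q. Neg \<phi> \<in> q} \<inter> types L M n = (- {q. \<phi> \<in> q}) \<inter> types L M n"
        using types_Neg[OF _ \<phi>] by auto
      then have "{q. Neg \<phi> \<in> q} \<in> D \<longleftrightarrow> - {q. \<phi> \<in> q} \<in> D"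
        by (rule ultrafilter_cong[OF D(1) \<open>types L M n \<in> D\<close>])
      then show "\<phi> \<in> p \<or> Neg \<phi> \<in> p"
        using \<phi> ultrafilter_Compl[OF D(1)] by (simp add: p_def Neg_mem_formulae)
    qed
    have "p \<in> C" if C: "C \<in> \<U>" for C
    proof (rule ccontr)
      assume "p \<notin> C"
      from closedin_Stone_spaceD[OF bspec[OF closed C] p this]
      obtain F where F: "F \<subseteq> p" "finite F" "\<forall>q\<in>types L M n. F \<subseteq> q \<longrightarrow> q \<notin> C"
        by (elim exE conjE) (rule that)
      then show False using ex[OF F(2,1), of C] C D(2) by auto
    qed
    then show ?thesis by auto
  qed simp
qed

section \<open>Automorphisms\<close>

lemma AutD:
  assumes "g \<in> Aut L M"
  shows "isomorphism L g M M" "inj_on g (universe M)" "g ` universe M = universe M"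
    "x \<in> universe M \<Longrightarrow> g x \<in> universe M"
  using assms unfolding Aut_def isomorphism_def embedding_def by auto

lemma embedding_comp:
  assumes f: "embedding L f A B" and g: "embedding L g B C"
  shows "embedding L (\<lambda>x. g (f x)) A C"
  unfolding embedding_def
proof (intro conjI ballI impI)
  have fA: "f ` universe A \<subseteq> universe B" "inj_on f (universe A)" using f unfolding embedding_def by auto
  have gB: "g ` universe B \<subseteq> universe C" "inj_on g (universe B)" using g unfolding embedding_def by auto
  show "inj_on (\<lambda>x. g (f x)) (universe A)"
    using comp_inj_on[OF fA(2) inj_on_subset[OF gB(2) fA(1)]] by (simp add: comp_def)
  show "(\<lambda>x. g (f x)) ` universe A \<subseteq> universe C" using fA gB by auto
  fix R xs assume R: "R \<in> symbols L" and xs: "xs \<in> lists (universe A)" "length xs = arity L R"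
  have "map f xs \<in> lists (universe B)" using xs(1) fA(1) by (auto simp: in_lists_conv_set)
  then have "map g (map f xs) \<in> interp C R \<longleftrightarrow> map f xs \<in> interp B R"
    using embedding_mem_interp[OF g R, of "map f xs"] xs(2) by (simp del: map_map)
  then show "xs \<in> interp A R \<longleftrightarrow> map (\<lambda>x. g (f x)) xs \<in> interp C R"
    using embedding_mem_interp[OF f R xs] by (simp add: comp_def)
qed

lemma isomorphism_comp:
  "isomorphism L f A B \<Longrightarrow> isomorphism L g B C \<Longrightarrow> isomorphism L (\<lambda>x. g (f x)) A C"
  unfolding isomorphism_def using embedding_comp[of L f A B g C] image_image[of g f "universe A"] by simp

lemma isomorphism_inv_into:
  assumes f: "isomorphism L f A B"
  shows "isomorphism L (inv_into (universe A) f) B A"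
proof -
  let ?g = "inv_into (universe A) f"
  have bij: "inj_on f (universe A)" "f ` universe A = universe B" and emb: "embedding L f A B"
    using f unfolding isomorphism_def embedding_def by auto
  have "inj_on ?g (universe B)" using inj_on_inv_into[of "universe B" f "universe A"] bij(2) by simp
  moreover have im: "?g ` universe B = universe A" 
    using inv_into_image_cancel[OF bij(1), of "universe A"] bij(2) by simp
  moreover have "xs \<in> interp B R \<longleftrightarrow> map ?g xs \<in> interp A R"
    if "R \<in> symbols L" "xs \<in> lists (universe B)" "length xs = arity L R" for R xs
  proof -
    have "map ?g xs \<in> lists (universe A)" using that(2) im by (auto simp: in_lists_conv_set)
    moreover have "map f (map ?g xs) = xs"
      using that(2) bij(2) by (auto simp: comp_def f_inv_into_f in_lists_conv_set intro!: map_idI)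
    ultimately show ?thesis
      using embedding_mem_interp[OF emb that(1), of "map ?g xs"] that(3) by simp
  qed
  ultimately show ?thesis unfolding isomorphism_def embedding_def by simp
qed

lemma Aut_comp: "f \<in> Aut L M \<Longrightarrow> g \<in> Aut L M \<Longrightarrow> (\<lambda>x. g (f x)) \<in> Aut L M"
  unfolding Aut_def using isomorphism_comp[of L f M M g M] by simp

lemma Aut_id: "(\<lambda>x. x) \<in> Aut L M"
  unfolding Aut_def isomorphism_def embedding_def by simp

text \<open>Automorphisms are total functions with arbitrary values off the universe, so they can be
  inverted on the universe only. Cancellation below therefore concerns formulae with parameters
  there.\<close>

lemma Aut_inverse:
  assumes "g \<in> Aut L M"
  obtains g' where "g' \<in> Aut L M" "\<And>x. x \<in> universe M \<Longrightarrow> g' (g x) = x"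
    "\<And>x. x \<in> universe M \<Longrightarrow> g (g' x) = x"
proof
  show "inv_into (universe M) g \<in> Aut L M"
    using isomorphism_inv_into[OF AutD(1)[OF assms]] unfolding Aut_def by simp
qed (use AutD[OF assms] in \<open>auto simp: f_inv_into_f\<close>)

lemma map_params_mem_formulae:
  "\<phi> \<in> formulae L C n \<Longrightarrow> g ` C \<subseteq> C' \<Longrightarrow> map_params g \<phi> \<in> formulae L C' n"
  unfolding formulae_def by (auto simp: formula.set_map)

lemma Aut_formulae:
  "g \<in> Aut L M \<Longrightarrow> \<phi> \<in> formulae L (universe M) n \<Longrightarrow> map_params g \<phi> \<in> formulae L (universe M) n"
  using map_params_mem_formulae[of \<phi> L "universe M" n g "universe M"] AutD(3)[of g L M] by simp

lemma map_params_cancel: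
  assumes "\<phi> \<in> formulae L C n" "\<And>x. x \<in> C \<Longrightarrow> f (g x) = x"
  shows "map_params f (map_params g \<phi>) = \<phi>"
  unfolding formula.map_comp using assms by (intro formula.map_ident_strong) (auto simp: formulae_def)

text \<open>Replaces the image in \<open>type_action\<close> by a preimage: moving \<open>p\<close>
  by \<open>g\<close> amounts to moving the formula back by the inverse.\<close>

lemma mem_type_action:
  assumes "p \<subseteq> formulae L (universe M) n" "\<phi> \<in> formulae L (universe M) n"
    "\<And>x. x \<in> universe M \<Longrightarrow> g' (g x) = x" "\<And>x. x \<in> universe M \<Longrightarrow> g (g' x) = x"
  shows "\<phi> \<in> type_action g p \<longleftrightarrow> map_params g' \<phi> \<in> p"
proof
  assume "\<phi> \<in> type_action g p"
  then obtain \<psi> where \<psi>: "\<psi> \<in> p" "\<phi> = map_params g \<psi>" unfolding type_action_def by auto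
  have "map_params g' \<phi> = \<psi>" unfolding \<psi>(2)
    by (rule map_params_cancel) (use \<psi> assms in auto)
  then show "map_params g' \<phi> \<in> p" using \<psi>(1) by simp
next
  assume "map_params g' \<phi> \<in> p"
  moreover have "\<phi> = map_params g (map_params g' \<phi>)"
    by (rule map_params_cancel[symmetric]) (use assms in auto)
  ultimately show "\<phi> \<in> type_action g p" unfolding type_action_def by blast
qed

lemma sat_tuple_Aut:
  assumes "g \<in> Aut L M" "\<phi> \<in> formulae L (universe M) n" "xs \<in> lists (universe M)" "length xs = n"
  shows "sat_tuple M (map g xs) (map_params g \<phi>) \<longleftrightarrow> sat_tuple M xs \<phi>"
proof -
  have j: "j < length xs" if "j \<in> free_vars \<phi>" for j using assms that unfolding formulae_def by auto
  have "sat_tuple M (map g xs) (map_params g \<phi>) \<longleftrightarrow> sat M (\<lambda>j. g (xs ! j)) (map_params g \<phi>)"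
    by (rule sat_cong) (use j in auto)
  also have "\<dots> \<longleftrightarrow> sat_tuple M xs \<phi>"
    by (rule sat_isomorphism[OF AutD(1)[OF assms(1)]]) (use assms j in \<open>auto simp: formulae_def\<close>)
  finally show ?thesis .
qed

lemma type_action_types:
  assumes g: "g \<in> Aut L M" and p: "p \<in> types L M n"
  shows "type_action g p \<in> types L M n"
proof -
  obtain g' where g': "g' \<in> Aut L M" "\<And>x. x \<in> universe M \<Longrightarrow> g' (g x) = x"
    "\<And>x. x \<in> universe M \<Longrightarrow> g (g' x) = x" using Aut_inverse[OF g] by blast
  note act = mem_type_action[of p L M n _ g' g, OF types_subset[OF p] _ g'(2,3)]
  show ?thesis unfolding types_def mem_Collect_eq
  proof (intro conjI allI impI ballI)
    show sub: "type_action g p \<subseteq> formulae L (universe M) n"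
      unfolding type_action_def using Aut_formulae[OF g] types_subset[OF p] by auto
    fix F assume F: "F \<subseteq> type_action g p" "finite F"
    \<comment> \<open>\<open>F\<close> is pulled back into \<open>p\<close> and realised there by
      \<open>xs\<close>; moving \<open>xs\<close> by \<open>g\<close> realises \<open>F\<close>
      itself.\<close>
    have "map_params g' ` F \<subseteq> p" using F act sub by auto
    then obtain xs where xs: "xs \<in> lists (universe M)" "length xs = n"
      "\<forall>\<phi>\<in>F. sat_tuple M xs (map_params g' \<phi>)"
      using types_finitely_satisfiable[OF p, of "map_params g' ` F"] F(2) by auto
    have "sat_tuple M (map g xs) \<phi>" if "\<phi> \<in> F" for \<phi>
    proof -
      have \<phi>: "\<phi> \<in> formulae L (universe M) n" using that F(1) sub by auto
      have "map_params g (map_params g' \<phi>) = \<phi>" by (rule map_params_cancel[OF \<phi>]) (rule g'(3))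
      then show ?thesis
        using sat_tuple_Aut[OF g Aut_formulae[OF g'(1) \<phi>] xs(1,2)] xs(3) that by simp
    qed
    moreover have "map g xs \<in> lists (universe M)" using xs(1) AutD(4)[OF g] by auto
    ultimately show "\<exists>xs\<in>lists (universe M). length xs = n \<and> (\<forall>\<phi>\<in>F. sat_tuple M xs \<phi>)"
      using xs(2) by (intro bexI[of _ "map g xs"]) auto
  next
    fix \<phi> assume \<phi>: "\<phi> \<in> formulae L (universe M) n"
    then show "\<phi> \<in> type_action g p \<or> Neg \<phi> \<in> type_action g p"
      using act[OF \<phi>] act[of "Neg \<phi>"] types_Neg[OF p Aut_formulae[OF g'(1) \<phi>]]
      by (simp add: Neg_mem_formulae)
  qed
qed

section \<open>Realising types in elementary extensions\<close>

text \<open>Agreement almost everywhere passes from functions to tuples because \<open>D\<close> is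
  closed under finite intersections. It makes the relations of the ultrapower independent of
  representatives.\<close>

lemma ultrafilter_map_eq:
  assumes D: "ultrafilter D"
    and c: "\<And>f g. f \<in> H \<Longrightarrow> g \<in> H \<Longrightarrow> c f = c g \<longleftrightarrow> {s. f s = g s} \<in> D"
    and "fs \<in> lists H" "gs \<in> lists H" "map c fs = map c gs"
  shows "{s. map (\<lambda>f. f s) fs = map (\<lambda>f. f s) gs} \<in> D"
proof -
  have "length fs = length gs" using assms(5) by (rule map_eq_imp_length_eq)
  then show ?thesis using assms(3-5)
  proof (induction fs gs rule: list_induct2)
    case Nil
    then show ?case using ultrafilter_UNIV[OF D] by simp
  next
    case (Cons f fs g gs)
    then have "{s. f s = g s} \<in> D" "{s. map (\<lambda>f. f s) fs = map (\<lambda>f. f s) gs} \<in> D"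
      using c[of f g] by simp_all
    then have "{s. f s = g s} \<inter> {s. map (\<lambda>f. f s) fs = map (\<lambda>f. f s) gs} \<in> D"
      using ultrafilter_Int[OF D] by simp
    moreover have "{s. f s = g s} \<inter> {s. map (\<lambda>f. f s) fs = map (\<lambda>f. f s) gs}
        = {s. map (\<lambda>f. f s) (f # fs) = map (\<lambda>f. f s) (g # gs)}" by auto
    ultimately show ?case by simp
  qed
qed

text \<open>\<open>H\<close> is a set of functions closed under Skolem functions, \<open>c\<close> identifies functions that
  agree \<open>D\<close>-almost everywhere, and \<open>N\<close> is the resulting substructure of the ultrapower.\<close>

lemma Los:
  fixes M :: "('r, 'a) struct" and N :: "('r, 'b) struct" and c :: "('x \<Rightarrow> 'a) \<Rightarrow> 'b"
  assumes D: "ultrafilter D"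
    and HM: "\<And>f s. f \<in> H \<Longrightarrow> f s \<in> universe M"
    and const: "\<And>a. a \<in> universe M \<Longrightarrow> (\<lambda>_. a) \<in> H"
    and c: "\<And>f g. f \<in> H \<Longrightarrow> g \<in> H \<Longrightarrow> c f = c g \<longleftrightarrow> {s. f s = g s} \<in> D"
    and wit: "\<And>\<phi> e i. well_formed L \<phi> \<Longrightarrow> params \<phi> \<subseteq> universe M \<Longrightarrow> (\<And>j. e j \<in> H) \<Longrightarrow>
      \<exists>f\<in>H. \<forall>s. (\<exists>a\<in>universe M. sat M ((\<lambda>j. e j s)(i := a)) \<phi>) \<longrightarrow>
        sat M ((\<lambda>j. e j s)(i := f s)) \<phi>"
    and uN: "universe N = c ` H"
    and iN: "\<And>R. interp N R = {map c fs | fs. fs \<in> lists H \<and>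
      {s. map (\<lambda>f. f s) fs \<in> interp M R} \<in> D}"
    and \<phi>: "well_formed L \<phi>" "params \<phi> \<subseteq> universe M"
    and e: "\<And>j. e j \<in> H"
  shows "sat N (\<lambda>j. c (e j)) (map_params (\<lambda>a. c (\<lambda>_. a)) \<phi>) \<longleftrightarrow> {s. sat M (\<lambda>j. e j s) \<phi>} \<in> D"
  using \<phi> e
proof (induction \<phi> arbitrary: e)
  case (Rel R ts)
  define T where "T t = (case t of Var j \<Rightarrow> e j | Par a \<Rightarrow> (\<lambda>_. a))" for t
  define fs where "fs = map T ts"
  have TH: "T t \<in> H" if "t \<in> set ts" for t
  proof (cases t)
    case (Par a)
    then have "a \<in> params (Rel R ts)" using that by force
    then show ?thesis using Rel.prems(2) const Par by (auto simp: T_def)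
  qed (simp add: T_def Rel.prems(3))
  then have fsH: "fs \<in> lists H" by (auto simp: fs_def)
  have "trm_val (\<lambda>j. c (e j)) (map_trm (\<lambda>a. c (\<lambda>_. a)) t) = c (T t)" for t
    by (cases t) (simp_all add: T_def)
  then have 1: "map (trm_val (\<lambda>j. c (e j))) (map (map_trm (\<lambda>a. c (\<lambda>_. a))) ts) = map c fs"
    by (simp add: fs_def)
  have "trm_val (\<lambda>j. e j s) t = T t s" for t s by (cases t) (simp_all add: T_def)
  then have 2: "map (trm_val (\<lambda>j. e j s)) ts = map (\<lambda>f. f s) fs" for s by (simp add: fs_def)
  have "map c fs \<in> interp N R \<longleftrightarrow> {s. map (\<lambda>f. f s) fs \<in> interp M R} \<in> D"
  proof
    assume "map c fs \<in> interp N R"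
    then obtain gs where gs: "gs \<in> lists H" "map c fs = map c gs"
      "{s. map (\<lambda>f. f s) gs \<in> interp M R} \<in> D" unfolding iN by auto
    have "{s. map (\<lambda>f. f s) fs = map (\<lambda>f. f s) gs} \<in> D"
      by (rule ultrafilter_map_eq[OF D c fsH gs(1,2)])
    then have "{s. map (\<lambda>f. f s) fs = map (\<lambda>f. f s) gs} \<inter> {s. map (\<lambda>f. f s) gs \<in> interp M R} \<in> D"
      using gs(3) ultrafilter_Int[OF D] by simp
    then show "{s. map (\<lambda>f. f s) fs \<in> interp M R} \<in> D"
      by (rule ultrafilter_mono[OF D]) auto
  next
    assume "{s. map (\<lambda>f. f s) fs \<in> interp M R} \<in> D"
    then show "map c fs \<in> interp N R" unfolding iN using fsH by auto
  qed
  then show ?case by (simp only: sat.simps formula.map 1 2)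
next
  case (Eq t t')
  define T where "T t = (case t of Var j \<Rightarrow> e j | Par a \<Rightarrow> (\<lambda>_. a))" for t
  have TH: "T t \<in> H" if "set_trm t \<subseteq> universe M" for t
    using that const Eq.prems(3) by (cases t) (auto simp: T_def)
  have 1: "trm_val (\<lambda>j. c (e j)) (map_trm (\<lambda>a. c (\<lambda>_. a)) t) = c (T t)" for t
    by (cases t) (simp_all add: T_def)
  have 2: "trm_val (\<lambda>j. e j s) t = T t s" for t s by (cases t) (simp_all add: T_def)
  have "T t \<in> H" "T t' \<in> H" using Eq.prems(2) TH by auto
  then show ?case using c by (simp add: 1 2)
next
  case (Neg \<phi>)
  have "{s. sat M (\<lambda>j. e j s) (Neg \<phi>)} = - {s. sat M (\<lambda>j. e j s) \<phi>}" by auto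
  then show ?case using Neg.IH[of e] Neg.prems ultrafilter_Compl[OF D] by simp
next
  case (Conj \<phi> \<psi>)
  have "{s. sat M (\<lambda>j. e j s) (Conj \<phi> \<psi>)}
      = {s. sat M (\<lambda>j. e j s) \<phi>} \<inter> {s. sat M (\<lambda>j. e j s) \<psi>}" by auto
  then show ?case using Conj.IH(1)[of e] Conj.IH(2)[of e] Conj.prems ultrafilter_Int[OF D] by simp
next
  case (Exi i \<phi>)
  have wf: "well_formed L \<phi>" "params \<phi> \<subseteq> universe M" using Exi.prems by simp_all
  have upd: "sat N ((\<lambda>j. c (e j))(i := c f)) (map_params (\<lambda>a. c (\<lambda>_. a)) \<phi>)
      \<longleftrightarrow> {s. sat M ((\<lambda>j. e j s)(i := f s)) \<phi>} \<in> D" if "f \<in> H" for f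
  proof -
    have "(\<lambda>j. c (e j))(i := c f) = (\<lambda>j. c ((e(i := f)) j))" by auto
    moreover have "(\<lambda>j. e j s)(i := f s) = (\<lambda>j. (e(i := f)) j s)" for s by auto
    ultimately show ?thesis using Exi.IH[OF wf, of "e(i := f)"] Exi.prems(3) that by simp
  qed
  \<comment> \<open>One member of \<open>H\<close> supplies a witness at every index that has one;
    this replaces the choice of an arbitrary function in the full ultrapower.\<close>
  obtain f where f: "f \<in> H" "\<And>s. (\<exists>a\<in>universe M. sat M ((\<lambda>j. e j s)(i := a)) \<phi>) \<Longrightarrow>
      sat M ((\<lambda>j. e j s)(i := f s)) \<phi>"
    using wit[of \<phi> e i, OF wf Exi.prems(3)] by (elim bexE) (rule that, assumption, drule spec, erule mp)
  have "sat N (\<lambda>j. c (e j)) (map_params (\<lambda>a. c (\<lambda>_. a)) (Exi i \<phi>)) \<longleftrightarrow>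
      (\<exists>f\<in>H. {s. sat M ((\<lambda>j. e j s)(i := f s)) \<phi>} \<in> D)"
    using upd by (simp add: uN)
  also have "\<dots> \<longleftrightarrow> {s. sat M (\<lambda>j. e j s) (Exi i \<phi>)} \<in> D"
  proof
    assume "\<exists>f\<in>H. {s. sat M ((\<lambda>j. e j s)(i := f s)) \<phi>} \<in> D"
    then obtain g where g: "g \<in> H" "{s. sat M ((\<lambda>j. e j s)(i := g s)) \<phi>} \<in> D" by (elim bexE)
    show "{s. sat M (\<lambda>j. e j s) (Exi i \<phi>)} \<in> D"
    proof (rule ultrafilter_mono[OF D g(2)], rule subsetI)
      fix s assume "s \<in> {s. sat M ((\<lambda>j. e j s)(i := g s)) \<phi>}"
      then show "s \<in> {s. sat M (\<lambda>j. e j s) (Exi i \<phi>)}"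
        using HM[OF g(1), of s] by (simp del: fun_upd_apply) (rule bexI)
    qed
  next
    assume A: "{s. sat M (\<lambda>j. e j s) (Exi i \<phi>)} \<in> D"
    have "{s. sat M ((\<lambda>j. e j s)(i := f s)) \<phi>} \<in> D"
      by (rule ultrafilter_mono[OF D A], rule subsetI) (use f(2) in simp)
    then show "\<exists>f\<in>H. {s. sat M ((\<lambda>j. e j s)(i := f s)) \<phi>} \<in> D" using f(1) by (rule bexI)
  qed
  finally show ?case .
qed

text \<open>\<open>G\<close> is closed under the functions that choose witnesses pointwise. A
  formula involves only finitely many members of \<open>H\<close>, so these are finitary operations,
  one for each variable and formula, and the closure is no larger than \<open>K\<close>.\<close>

lemma Skolem_closed_functions:
  fixes L :: "'r language" and M :: "('r, 'a) struct" and G :: "('x \<Rightarrow> 'a) set"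
    and K :: "'k set"
  assumes L: "countable (symbols L)" and u: "u \<in> universe M"
    and K: "infinite K" "|universe M| \<le>o |K|" "|G| \<le>o |K|"
    and GM: "\<forall>f\<in>G. \<forall>s. f s \<in> universe M"
  shows "\<exists>H. G \<subseteq> H \<and> |H| \<le>o |K| \<and> (\<forall>f\<in>H. \<forall>s. f s \<in> universe M) \<and>
    (\<forall>\<phi> e i. well_formed L \<phi> \<longrightarrow> params \<phi> \<subseteq> universe M \<longrightarrow> (\<forall>j. e j \<in> H) \<longrightarrow>
      (\<exists>f\<in>H. \<forall>s. (\<exists>a\<in>universe M. sat M ((\<lambda>j. e j s)(i := a)) \<phi>) \<longrightarrow>
        sat M ((\<lambda>j. e j s)(i := f s)) \<phi>))"
proof -
  define F where "F = {\<phi> :: ('r, 'a) formula. well_formed L \<phi> \<and> params \<phi> \<subseteq> universe M}"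
  \<comment> \<open>Where no witness exists the value is the default \<open>u\<close>, so that
    values never leave the universe.\<close>
  define w where "w i \<phi> e = (\<lambda>s :: 'x. if \<exists>a\<in>universe M. sat M ((\<lambda>j. e j s)(i := a)) \<phi>
      then SOME a. a \<in> universe M \<and> sat M ((\<lambda>j. e j s)(i := a)) \<phi> else u)" for i \<phi> e
  have w: "w i \<phi> e s \<in> universe M \<and> ((\<exists>a\<in>universe M. sat M ((\<lambda>j. e j s)(i := a)) \<phi>) \<longrightarrow>
      sat M ((\<lambda>j. e j s)(i := w i \<phi> e s)) \<phi>)" for i \<phi> e s
  proof (cases "\<exists>a\<in>universe M. sat M ((\<lambda>j. e j s)(i := a)) \<phi>")
    case True
    then have "\<exists>a. a \<in> universe M \<and> sat M ((\<lambda>j. e j s)(i := a)) \<phi>" by (simp only: Bex_def)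
    from someI_ex[OF this] show ?thesis unfolding w_def if_P[OF True] by blast
  next
    case False
    then show ?thesis using u by (simp add: w_def)
  qed
  define I where "I = Inl ` G \<union> Inr ` ((UNIV :: nat set) \<times> F)"
  define f where "f k fs = (case k of Inl g \<Rightarrow> g | Inr (i, \<phi>) \<Rightarrow> w i \<phi> (\<lambda>j. fs ! j))"
    for k and fs :: "('x \<Rightarrow> 'a) list"
  define H where "H = closure_under f I"
  have fs: "f (Inl g) fs = g" "f (Inr (i, \<phi>)) fs = w i \<phi> (\<lambda>j. fs ! j)" for g i \<phi> fs
    by (simp_all add: f_def)
  show ?thesis
  proof (intro exI[of _ H] conjI allI ballI impI)
    show "G \<subseteq> H"
    proof
      fix g assume "g \<in> G"
      then have "f (Inl g) [] \<in> H" unfolding H_def by (intro closure_under.intros) (simp_all add: I_def)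
      then show "g \<in> H" by (simp add: fs)
    qed
    have "|I| \<le>o |K|" unfolding I_def F_def
      by (intro card_of_Un_ordLeq_infinite card_of_image_ordLeq card_of_Times_ordLeq_infinite
          card_of_formulae K L iffD1[OF infinite_iff_card_of_nat])
    then show "|H| \<le>o |K|" unfolding H_def by (rule card_of_closure_under[OF K(1)])
    show "g s \<in> universe M" if "g \<in> H" for g s
      using that unfolding H_def
    proof cases
      case (1 k xs)
      show ?thesis
      proof (cases k)
        case (Inl g')
        then have "g' \<in> G" using 1(2) by (auto simp: I_def)
        then show ?thesis using GM 1(1) Inl by (simp add: fs)
      next
        case (Inr q)
        then show ?thesis using w 1(1) by (cases q) (simp add: fs)
      qed
    qed
    fix \<phi> :: "('r, 'a) formula" and e :: "nat \<Rightarrow> 'x \<Rightarrow> 'a" and i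
    assume \<phi>: "well_formed L \<phi>" "params \<phi> \<subseteq> universe M" and e: "\<forall>j. e j \<in> H"
    \<comment> \<open>The assignment \<open>e\<close> is infinite, but only its first
      \<open>m\<close> entries matter for \<open>\<phi>\<close>; they form the finite list passed to
      the operation.\<close>
    obtain m where m: "free_vars \<phi> \<subseteq> {..<m}" using free_vars_bound[of \<phi>] by (elim exE)
    define g where "g = f (Inr (i, \<phi>)) (map e [0..<m])"
    have "g \<in> H" unfolding g_def H_def
    proof (rule closure_under.intros)
      show "Inr (i, \<phi>) \<in> I" using \<phi> by (simp add: I_def F_def)
      show "map e [0..<m] \<in> lists (closure_under f I)" using e by (auto simp: H_def)
    qed
    moreover have "(\<exists>a\<in>universe M. sat M ((\<lambda>j. e j s)(i := a)) \<phi>) \<longrightarrow>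
        sat M ((\<lambda>j. e j s)(i := g s)) \<phi>" for s
    proof -
      have "sat M ((\<lambda>j. (map e [0..<m] ! j) s)(i := a)) \<phi> = sat M ((\<lambda>j. e j s)(i := a)) \<phi>" for a
        by (rule sat_cong) (use m in auto)
      then show ?thesis using w[where i = i and \<phi> = \<phi> and e = "\<lambda>j. map e [0..<m] ! j" and s = s]
        by (simp add: g_def fs del: fun_upd_apply)
    qed
    ultimately show "\<exists>f\<in>H. \<forall>s. (\<exists>a\<in>universe M. sat M ((\<lambda>j. e j s)(i := a)) \<phi>) \<longrightarrow>
        sat M ((\<lambda>j. e j s)(i := f s)) \<phi>" by (intro bexI[of _ g]) simp_all
  qed
qed

text \<open>An ultrafilter on tuples of \<open>M\<close> containing, for each formula of
  \<open>p\<close>, the set of tuples that satisfy it makes the coordinate functions realise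
  \<open>p\<close>. In the carrier, \<open>'a\<close> makes room for \<open>M\<close>,
  \<open>nat\<close> makes it infinite, and \<open>'n\<close> leaves it as large as desired.\<close>

lemma type_realised:
  fixes L :: "'r language" and M :: "('r, 'a) struct"
  assumes L: "countable (symbols L)" and M: "is_struct L M" and p: "p \<in> types L M n"
  obtains N :: "('r, 'a + nat + 'n) struct" and h es
  where "is_struct L N" "elementary_embedding L h M N" "es \<in> lists (universe N)" "length es = n"
    "\<forall>\<phi>\<in>formulae L (universe M) n. \<phi> \<in> p \<longleftrightarrow> sat_tuple N es (map_params h \<phi>)"
proof -
  obtain u where u: "u \<in> universe M" using M unfolding is_struct_def by auto
  define S where "S = {s \<in> lists (universe M). length s = n}"
  \<comment> \<open>Finite satisfiability of \<open>p\<close> gives the finite intersection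
    property. \<open>S\<close> is added so that almost every index is an \<open>n\<close>-tuple over
    \<open>M\<close>.\<close>
  define B where "B = insert S ((\<lambda>\<phi>. {s \<in> S. sat_tuple M s \<phi>}) ` p)"
  have "\<exists>D. ultrafilter D \<and> B \<subseteq> D"
  proof (rule ultrafilter_exists)
    fix F assume F: "finite F" "F \<subseteq> B"
    then have "F - {S} \<subseteq> (\<lambda>\<phi>. {s \<in> S. sat_tuple M s \<phi>}) ` p" by (auto simp: B_def)
    from finite_subset_image[OF _ this] F(1)
    obtain F' where F': "F' \<subseteq> p" "finite F'" "F - {S} = (\<lambda>\<phi>. {s \<in> S. sat_tuple M s \<phi>}) ` F'"
      by (auto simp del: Diff_subset_conv)
    then obtain s where "s \<in> S" "\<forall>\<phi>\<in>F'. sat_tuple M s \<phi>"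
      using types_finitely_satisfiable[OF p F'(2,1)] by (auto simp: S_def)
    then have "s \<in> \<Inter>(F - {S})" unfolding F'(3) by simp
    then have "s \<in> \<Inter>F" using \<open>s \<in> S\<close> by auto
    then show "\<Inter>F \<noteq> {}" by auto
  qed
  then obtain D where D: "ultrafilter D" "S \<in> D" and pD: "\<And>\<phi>. \<phi> \<in> p \<Longrightarrow> {s \<in> S. sat_tuple M s \<phi>} \<in> D"
    by (auto simp: B_def)
  define K where "K = (UNIV :: ('a + nat + 'n) set)"
  have K_inf: "infinite K"
  proof
    assume "finite K"
    then have "finite ((Inr \<circ> Inl) ` (UNIV :: nat set) :: ('a + nat + 'n) set)"
      by (rule rev_finite_subset) (simp add: K_def)
    then show False by (simp add: finite_image_iff inj_on_def)
  qed
  have K_M: "|universe M| \<le>o |K|"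
    using card_of_ordLeq[of "universe M" K] by (auto simp: K_def intro!: exI[of _ Inl])
  \<comment> \<open>The coordinate functions, with default \<open>u\<close> at lists that are not
    \<open>n\<close>-tuples over \<open>M\<close>.\<close>
  define X where "X i s = (if s \<in> S then s ! i else u)" for i s
  have XM: "X i s \<in> universe M" if "i < n" for i s
    using that u by (auto simp: X_def S_def in_lists_conv_set)
  define G where "G = (\<lambda>a _. a) ` universe M \<union> X ` {..<n}"
  have "|X ` {..<n}| \<le>o |K|"
    by (rule card_of_image_ordLeq, rule card_of_subset_ordLeq[OF subset_UNIV],
        rule iffD1[OF infinite_iff_card_of_nat K_inf])
  then have G: "|G| \<le>o |K|"
    unfolding G_def by (intro card_of_Un_ordLeq_infinite[OF K_inf] card_of_image_ordLeq[OF K_M])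
  have GM: "\<forall>f\<in>G. \<forall>s. f s \<in> universe M"
    using XM by (auto simp: G_def)
  obtain H where H: "G \<subseteq> H" "|H| \<le>o |K|" "\<forall>f\<in>H. \<forall>s. f s \<in> universe M"
    and wit: "\<forall>\<phi> e i. well_formed L \<phi> \<longrightarrow> params \<phi> \<subseteq> universe M \<longrightarrow> (\<forall>j. e j \<in> H) \<longrightarrow>
      (\<exists>f\<in>H. \<forall>s. (\<exists>a\<in>universe M. sat M ((\<lambda>j. e j s)(i := a)) \<phi>) \<longrightarrow>
        sat M ((\<lambda>j. e j s)(i := f s)) \<phi>)"
    using Skolem_closed_functions[OF L u K_inf K_M G GM] by (elim exE conjE) (rule that)
  have const: "(\<lambda>_. a) \<in> H" if "a \<in> universe M" for a using H(1) that by (auto simp: G_def)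
  have XH: "X i \<in> H" if "i < n" for i using H(1) that by (auto simp: G_def)
  \<comment> \<open>The size of \<open>H\<close> allows its members to be named by elements of the
    prescribed carrier type.\<close>
  obtain j :: "('a list \<Rightarrow> 'a) \<Rightarrow> 'a + nat + 'n" where j: "inj_on j H"
    using H(2) card_of_ordLeq[of H K] by auto
  \<comment> \<open>One representative for each class modulo \<open>D\<close>: equivalent functions
    give the same defining condition, so \<open>SOME\<close> returns the same function.\<close>
  define rep where "rep f = (SOME g. g \<in> H \<and> {s. f s = g s} \<in> D)" for f
  have rep: "rep f \<in> H" "{s. f s = rep f s} \<in> D" if "f \<in> H" for f
  proof -
    have "\<exists>g. g \<in> H \<and> {s. f s = g s} \<in> D"
      by (rule exI[of _ f]) (use that ultrafilter_UNIV[OF D(1)] in simp)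
    from someI_ex[OF this] show "rep f \<in> H" "{s. f s = rep f s} \<in> D" by (simp_all add: rep_def)
  qed
  have rep_eq: "rep f = rep g \<longleftrightarrow> {s. f s = g s} \<in> D" if "f \<in> H" "g \<in> H" for f g
  proof
    assume "rep f = rep g"
    then have "{s. f s = rep f s} \<inter> {s. g s = rep f s} \<in> D"
      using rep(2)[OF that(1)] rep(2)[OF that(2)] ultrafilter_Int[OF D(1)] by simp
    then show "{s. f s = g s} \<in> D" by (rule ultrafilter_mono[OF D(1)]) auto
  next
    assume fg: "{s. f s = g s} \<in> D"
    have "{s. f s = k s} \<in> D \<longleftrightarrow> {s. g s = k s} \<in> D" for k
      by (rule ultrafilter_cong[OF D(1) fg]) auto
    then show "rep f = rep g" by (simp add: rep_def)
  qed
  define c where "c f = j (rep f)" for f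
  have c: "c f = c g \<longleftrightarrow> {s. f s = g s} \<in> D" if "f \<in> H" "g \<in> H" for f g
    using rep_eq[OF that] inj_on_eq_iff[OF j rep(1)[OF that(1)] rep(1)[OF that(2)]] by (simp add: c_def)
  define N :: "('r, 'a + nat + 'n) struct" where "N = \<lparr>universe = c ` H,
    interp = (\<lambda>R. {map c fs | fs. fs \<in> lists H \<and> {s. map (\<lambda>f. f s) fs \<in> interp M R} \<in> D})\<rparr>"
  define h where "h a = c (\<lambda>_. a)" for a
  have uN: "universe N = c ` H" by (simp add: N_def)
  have iN: "interp N R = {map c fs | fs. fs \<in> lists H \<and> {s. map (\<lambda>f. f s) fs \<in> interp M R} \<in> D}" for R
    by (simp add: N_def)
  have Los: "sat N (\<lambda>j. c (e j)) (map_params h \<phi>) \<longleftrightarrow> {s. sat M (\<lambda>j. e j s) \<phi>} \<in> D"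
    if "well_formed L \<phi>" "params \<phi> \<subseteq> universe M" "\<And>j. e j \<in> H" for \<phi> e
    unfolding h_def 
  proof (rule Los[OF D(1) _ const c _ uN iN that])
    show "f s \<in> universe M" if "f \<in> H" for f s using H(3) that by simp
    show "\<exists>f\<in>H. \<forall>s. (\<exists>a\<in>universe M. sat M ((\<lambda>j. e j s)(i := a)) \<phi>) \<longrightarrow>
        sat M ((\<lambda>j. e j s)(i := f s)) \<phi>"
      if "well_formed L \<phi>" "params \<phi> \<subseteq> universe M" "\<And>j. e j \<in> H" for \<phi> e i
      using wit that by simp
  qed
  show thesis
  proof
    show "is_struct L N" unfolding is_struct_def
    proof (intro conjI ballI subsetI)
      show "universe N \<noteq> {}" using const[OF u] by (auto simp: uN)
      fix R xs assume R: "R \<in> symbols L" and "xs \<in> interp N R"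
      then obtain fs where fs: "xs = map c fs" "fs \<in> lists H"
        "{s. map (\<lambda>f. f s) fs \<in> interp M R} \<in> D" unfolding iN by auto
      have "interp M R \<subseteq> {xs \<in> lists (universe M). length xs = arity L R}"
        using M R unfolding is_struct_def by simp
      moreover obtain s where "map (\<lambda>f. f s) fs \<in> interp M R" using ultrafilter_ex_mem[OF D(1) fs(3)] by auto
      ultimately have "length (map (\<lambda>f. f s) fs) = arity L R" by blast
      then show "xs \<in> {xs \<in> lists (universe N). length xs = arity L R}" using fs by (auto simp: uN)
    qed
    show "elementary_embedding L h M N" unfolding elementary_embedding_def
    proof (intro conjI allI ballI impI)
      show "h ` universe M \<subseteq> universe N" using const by (auto simp: h_def uN)
      fix m xs and \<phi> :: "('r, 'a) formula"
      assume \<phi>: "\<phi> \<in> formulae L {} m" and xs: "xs \<in> lists (universe M)" "length xs = m"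
      \<comment> \<open>\<open>Los\<close> requires every entry of the assignment to lie in
        \<open>H\<close>; beyond the tuple the constant function \<open>u\<close> fills in.\<close>
      define e :: "nat \<Rightarrow> 'a list \<Rightarrow> 'a" where "e i = (\<lambda>_. if i < m then xs ! i else u)" for i
      have v: "i < m" if "i \<in> free_vars \<phi>" for i using that \<phi> by (auto simp: formulae_def)
      have "e i \<in> H" for i
        using const[of "if i < m then xs ! i else u"] u xs by (auto simp: e_def in_lists_conv_set)
      then have "sat N (\<lambda>j. c (e j)) (map_params h \<phi>) \<longleftrightarrow> {s. sat M (\<lambda>j. e j s) \<phi>} \<in> D"
        using \<phi> by (intro Los) (auto simp: formulae_def)
      moreover have "sat M (\<lambda>j. e j s) \<phi> \<longleftrightarrow> sat_tuple M xs \<phi>" for s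
        by (rule sat_cong) (simp add: e_def v)
      moreover have "sat N (\<lambda>j. c (e j)) (map_params h \<phi>) \<longleftrightarrow> sat_tuple N (map h xs) (map_params h \<phi>)"
        by (rule sat_cong) (use xs in \<open>simp add: e_def v h_def\<close>)
      ultimately show "sat_tuple M xs \<phi> \<longleftrightarrow> sat_tuple N (map h xs) (map_params h \<phi>)"
        using D(1) ultrafilter_UNIV[OF D(1)] by (auto simp: ultrafilter_def)
    qed
    show "map (\<lambda>i. c (X i)) [0..<n] \<in> lists (universe N)" using XH by (auto simp: uN)
    show "length (map (\<lambda>i. c (X i)) [0..<n]) = n" by simp
    show "\<forall>\<phi>\<in>formulae L (universe M) n. \<phi> \<in> p
        \<longleftrightarrow> sat_tuple N (map (\<lambda>i. c (X i)) [0..<n]) (map_params h \<phi>)"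
    proof
      fix \<phi> :: "('r, 'a) formula"
      assume \<phi>: "\<phi> \<in> formulae L (universe M) n"
      define e where "e i = (if i < n then X i else (\<lambda>_. u))" for i
      have v: "i < n" if "i \<in> free_vars \<phi>" for i using that \<phi> by (auto simp: formulae_def)
      have "e i \<in> H" for i using const[OF u] XH by (simp add: e_def)
      then have "sat N (\<lambda>j. c (e j)) (map_params h \<phi>) \<longleftrightarrow> {s. sat M (\<lambda>j. e j s) \<phi>} \<in> D"
        using \<phi> by (intro Los) (auto simp: formulae_def)
      also have "\<dots> \<longleftrightarrow> {s. sat_tuple M s \<phi>} \<in> D"
      proof (rule ultrafilter_cong[OF D(1,2)])
        have "sat M (\<lambda>j. e j s) \<phi> \<longleftrightarrow> sat_tuple M s \<phi>" if "s \<in> S" for s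
          by (rule sat_cong) (simp add: e_def v X_def that)
        then show "{s. sat M (\<lambda>j. e j s) \<phi>} \<inter> S = {s. sat_tuple M s \<phi>} \<inter> S" by auto
      qed
      also have "\<dots> \<longleftrightarrow> \<phi> \<in> p"
      proof
        assume A: "{s. sat_tuple M s \<phi>} \<in> D"
        show "\<phi> \<in> p"
        proof (rule ccontr)
          assume "\<phi> \<notin> p"
          then have "{s \<in> S. sat_tuple M s (Neg \<phi>)} \<in> D" using pD[of "Neg \<phi>"] types_Neg[OF p \<phi>] by simp
          then have "{s. sat_tuple M s \<phi>} \<inter> {s \<in> S. sat_tuple M s (Neg \<phi>)} \<in> D"
            using A ultrafilter_Int[OF D(1)] by simp
          from ultrafilter_ex_mem[OF D(1) this] show False by auto
        qed
      next
        assume "\<phi> \<in> p"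
        then show "{s. sat_tuple M s \<phi>} \<in> D"
          by (intro ultrafilter_mono[OF D(1) pD]) auto
      qed
      finally have "sat N (\<lambda>j. c (e j)) (map_params h \<phi>) \<longleftrightarrow> \<phi> \<in> p" .
      moreover have "sat N (\<lambda>j. c (e j)) (map_params h \<phi>)
          \<longleftrightarrow> sat_tuple N (map (\<lambda>i. c (X i)) [0..<n]) (map_params h \<phi>)"
        by (rule sat_cong) (simp add: e_def v)
      ultimately show "\<phi> \<in> p \<longleftrightarrow> sat_tuple N (map (\<lambda>i. c (X i)) [0..<n]) (map_params h \<phi>)" by simp
    qed
  qed
qed

section \<open>Copies of finite structures\<close>

lemma substruct_simps:
  "interp (substruct M X) R = interp M R \<inter> lists X" "universe (substruct M X) = X"
  by (simp_all add: substruct_def)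

lemma embedding_substructD:
  assumes "embedding L f A (substruct M X)" "X \<subseteq> universe M"
  shows "embedding L f A M"
  unfolding embedding_def
proof (intro conjI ballI impI)
  have fX: "f ` universe A \<subseteq> X" "inj_on f (universe A)"
    using assms(1) by (simp_all add: embedding_def substruct_simps)
  then show "inj_on f (universe A)" "f ` universe A \<subseteq> universe M" using assms(2) by auto
  fix R xs assume xs: "R \<in> symbols L" "xs \<in> lists (universe A)" "length xs = arity L R"
  then have "map f xs \<in> lists X" using fX(1) by (auto simp: in_lists_conv_set)
  then show "xs \<in> interp A R \<longleftrightarrow> map f xs \<in> interp M R"
    using embedding_mem_interp[OF assms(1) xs] by (simp add: substruct_simps)
qed

lemma embedding_substructI:
  assumes f: "embedding L f A M" "f ` universe A \<subseteq> X"
  shows "embedding L f A (substruct M X)"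
  unfolding embedding_def
proof (intro conjI ballI impI)
  show "inj_on f (universe A)" using f(1) by (simp add: embedding_def)
  show "f ` universe A \<subseteq> universe (substruct M X)" using f(2) by (simp add: substruct_simps)
  fix R xs assume xs: "R \<in> symbols L" "xs \<in> lists (universe A)" "length xs = arity L R"
  then have "map f xs \<in> lists X" using f(2) by (auto simp: in_lists_conv_set)
  then show "xs \<in> interp A R \<longleftrightarrow> map f xs \<in> interp (substruct M X) R"
    using embedding_mem_interp[OF f(1) xs] by (simp add: substruct_simps)
qed

lemma embedding_image_isomorphism:
  "embedding L f A M \<Longrightarrow> isomorphism L f A (substruct M (f ` universe A))"
  unfolding isomorphism_def using embedding_substructI[of L f A M "f ` universe A"]
  by (simp add: substruct_simps)

lemma embedding_range: "embedding L f A M \<Longrightarrow> f ` universe A \<subseteq> universe M"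
  by (simp add: embedding_def)

lemma embedding_Aut: "g \<in> Aut L M \<Longrightarrow> embedding L g M M"
  by (simp add: Aut_def isomorphism_def)

lemma copiesI: "embedding L f A B \<Longrightarrow> map f as \<in> copies L B A as"
  unfolding copies_def by (rule CollectI, rule exI[of _ f]) simp

lemma copiesE:
  assumes "as' \<in> copies L B A as"
  obtains f where "as' = map f as" "embedding L f A B"
  using assms unfolding copies_def mem_Collect_eq by (elim exE conjE) (rule that)

text \<open>Going back along one embedding of \<open>A\<close> and forth along the other is an
  isomorphism between finite substructures, so it extends to an automorphism.\<close>

lemma copies_conjugate:
  assumes "ultrahomogeneous L M" and A: "finite (universe A)" "set as = universe A"
    and as1: "as1 \<in> copies L M A as" and as2: "as2 \<in> copies L M A as"
  obtains g where "g \<in> Aut L M" "as2 = map g as1"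
proof -
  obtain f1 where f1: "as1 = map f1 as" "embedding L f1 A M" by (rule copiesE[OF as1])
  obtain f2 where f2: "as2 = map f2 as" "embedding L f2 A M" by (rule copiesE[OF as2])
  let ?f = "\<lambda>x. f2 (inv_into (universe A) f1 x)"
  have "isomorphism L ?f (substruct M (f1 ` universe A)) (substruct M (f2 ` universe A))"
    using isomorphism_comp[OF isomorphism_inv_into[OF embedding_image_isomorphism[OF f1(2)]]
        embedding_image_isomorphism[OF f2(2)]] .
  moreover have "finite (f1 ` universe A)" "finite (f2 ` universe A)" using A by auto
  ultimately obtain g where g: "g \<in> Aut L M" "\<forall>x\<in>f1 ` universe A. g x = ?f x"
    using assms(1) embedding_range[OF f1(2)] embedding_range[OF f2(2)]
    unfolding ultrahomogeneous_def by metis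
  have "inj_on f1 (universe A)" using f1(2) by (simp add: embedding_def)
  then have "g (f1 x) = f2 x" if "x \<in> universe A" for x using g(2) that by simp
  then have "as2 = map g as1" using f1(1) f2(1) A(2) by simp
  then show thesis using g(1) that by blast
qed

section \<open>Fixed points yield the Ramsey property\<close>

text \<open>Finitely many formulae true of \<open>es\<close> yield a sentence with parameters from
  \<open>M\<close> that is true in \<open>N\<close>: the existential closure of their conjunction.
  It transfers to \<open>M\<close>, where its witnesses satisfy the formulae.\<close>

lemma tuple_type_types:
  assumes M: "is_struct L M" and N: "is_struct L N" and h: "elementary_embedding L h M N"
    and es: "es \<in> lists (universe N)" "length es = n"
  shows "{\<phi> \<in> formulae L (universe M) n. sat_tuple N es (map_params h \<phi>)} \<in> types L M n"
    (is "?q \<in> _")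
  unfolding types_def
proof (intro CollectI conjI allI impI ballI)
  show "?q \<subseteq> formulae L (universe M) n" by auto
next
  fix F assume F: "F \<subseteq> ?q" "finite F"
  obtain \<phi>s where \<phi>s: "set \<phi>s = F" using finite_list[OF F(2)] by (elim exE)
  have M0: "universe M \<noteq> {}" and N0: "universe N \<noteq> {}" using M N by (simp_all add: is_struct_def)
  define \<psi> where "\<psi> = Conjs \<phi>s"
  have \<psi>: "\<psi> \<in> formulae L (universe M) n"
    unfolding \<psi>_def by (rule Conjs_mem_formulae) (use F(1) \<phi>s in auto)
  then have v: "j < n" if "j \<in> free_vars \<psi>" for j using that by (auto simp: formulae_def)
  have Ex: "free_vars (Exis n \<psi>) \<subseteq> free_vars \<psi> - {..<n}" for \<psi> :: "('a, 'b) formula"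
    by (induction n arbitrary: \<psi>) (simp, fastforce simp: less_Suc_eq)
  have "sat_tuple N es (map_params h \<psi>)"
    unfolding \<psi>_def sat_map_params_Conjs[OF N0] using F(1) \<phi>s by auto
  \<comment> \<open>The sentence will be evaluated at the empty tuple, so \<open>[] ! j\<close>
    appears as a dummy value for variables from \<open>n\<close> on, none of which is free in
    \<open>\<psi>\<close>.\<close>
  then have "sat N (\<lambda>j. if j < n then es ! j else [] ! j) (map_params h \<psi>)"
    using sat_cong[of "map_params h \<psi>" "\<lambda>j. if j < n then es ! j else [] ! j" "\<lambda>j. es ! j" N] v by simp
  then have "sat_tuple N (map h []) (map_params h (Exis n \<psi>))"
    using es by (simp add: sat_Exis) (rule bexI[of _ es], simp_all)
  moreover have "Exis n \<psi> \<in> formulae L (universe M) 0"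
    using \<psi> Ex[of \<psi>] by (auto simp: formulae_def)
  ultimately have "sat_tuple M [] (Exis n \<psi>)"
    using elementary_embedding_params[OF h, of "Exis n \<psi>" 0 "[]"] by simp
  then obtain xs where xs: "xs \<in> lists (universe M)" "length xs = n"
    "sat M (\<lambda>j. if j < n then xs ! j else [] ! j) \<psi>" unfolding sat_Exis by (elim bexE conjE)
  have "sat_tuple M xs \<psi>"
    using sat_cong[of \<psi> "\<lambda>j. if j < n then xs ! j else [] ! j" "\<lambda>j. xs ! j" M] v xs(3) by simp
  then show "\<exists>xs\<in>lists (universe M). length xs = n \<and> (\<forall>\<phi>\<in>F. sat_tuple M xs \<phi>)"
    using xs(1,2) \<phi>s by (intro bexI[of _ xs]) (simp_all add: \<psi>_def sat_Conjs[OF M0])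
next
  fix \<phi> assume "\<phi> \<in> formulae L (universe M) n"
  then show "\<phi> \<in> ?q \<or> Neg \<phi> \<in> ?q" by (simp add: Neg_mem_formulae)
qed

text \<open>The set is the closure of the orbit of \<open>q\<close>: a finite \<open>F\<close> lies
  in a translate of \<open>q\<close> iff some automorphism maps \<open>F\<close> into
  \<open>q\<close>, and finite parts of \<open>p\<close> describe its neighbourhoods.\<close>

lemma orbit_closure_subflow:
  assumes q: "q \<in> types L M n"
  shows "subflow L M n {p \<in> types L M n. \<forall>F\<subseteq>p. finite F \<longrightarrow> (\<exists>g\<in>Aut L M. map_params g ` F \<subseteq> q)}"
    (is "subflow L M n ?Y")
  unfolding subflow_def
proof (intro conjI ballI)
  have "\<exists>g\<in>Aut L M. map_params g ` F \<subseteq> q" if "F \<subseteq> q" for F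
    by (rule bexI[OF _ Aut_id]) (use that in \<open>simp add: formula.map_ident\<close>)
  then have "q \<in> ?Y" using q by simp
  then show "?Y \<noteq> {}" by auto
  show "closedin (Stone_space L M n) ?Y"
  proof (rule closedin_Stone_spaceI)
    fix p assume "p \<in> types L M n" "p \<notin> ?Y"
    have "\<exists>F. F \<subseteq> p \<and> finite F \<and> \<not> (\<exists>g\<in>Aut L M. map_params g ` F \<subseteq> q)"
    proof (rule ccontr)
      assume "\<not> ?thesis"
      then have "p \<in> ?Y" using \<open>p \<in> types L M n\<close> by simp
      then show False using \<open>p \<notin> ?Y\<close> by contradiction
    qed
    then obtain F where F: "F \<subseteq> p" "finite F" "\<not> (\<exists>g\<in>Aut L M. map_params g ` F \<subseteq> q)"
      by (elim exE conjE)
    have "r \<notin> ?Y" if "F \<subseteq> r" for r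
    proof
      assume "r \<in> ?Y"
      then have "\<exists>g\<in>Aut L M. map_params g ` F \<subseteq> q" using that F(2) by simp
      then show False using F(3) by simp
    qed
    then show "\<exists>F\<subseteq>p. finite F \<and> (\<forall>q\<in>types L M n. F \<subseteq> q \<longrightarrow> q \<notin> ?Y)"
      using F(1,2) by (intro exI[of _ F]) simp
  qed auto
  fix g p assume g: "g \<in> Aut L M" and p: "p \<in> ?Y"
  obtain g' where g': "g' \<in> Aut L M" "\<And>x. x \<in> universe M \<Longrightarrow> g' (g x) = x"
    "\<And>x. x \<in> universe M \<Longrightarrow> g (g' x) = x" using Aut_inverse[OF g] by blast
  have pt: "p \<in> types L M n" using p by simp
  have "\<exists>k\<in>Aut L M. map_params k ` F \<subseteq> q" if F: "F \<subseteq> type_action g p" "finite F" for F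
  proof -
    from F(1) have "F \<subseteq> map_params g ` p" by (simp add: type_action_def)
    from finite_subset_image[OF F(2) this] obtain F' where F': "F' \<subseteq> p" "finite F'" "F = map_params g ` F'"
      by auto
    have "\<exists>k\<in>Aut L M. map_params k ` F' \<subseteq> q" using p F'(1,2) by simp
    then obtain k where k: "k \<in> Aut L M" "map_params k ` F' \<subseteq> q" by (elim bexE)
    \<comment> \<open>If \<open>k\<close> moves \<open>F'\<close> into \<open>q\<close>, then
      \<open>k\<close> after the inverse of \<open>g\<close> moves the translate \<open>F\<close> of
      \<open>F'\<close> into \<open>q\<close>.\<close>
    have "map_params (\<lambda>x. k (g' x)) \<phi> \<in> q" if \<phi>: "\<phi> \<in> F" for \<phi>
    proof -
      obtain \<psi> where \<psi>: "\<psi> \<in> F'" "\<phi> = map_params g \<psi>" using \<phi> F'(3) by auto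
      have "\<psi> \<in> formulae L (universe M) n" using \<psi>(1) F'(1) types_subset[OF pt] by auto
      then have "map_params g' \<phi> = \<psi>" unfolding \<psi>(2) by (rule map_params_cancel) (rule g'(2))
      then have "map_params (\<lambda>x. k (g' x)) \<phi> = map_params k \<psi>"
        using formula.map_comp[of k g' \<phi>] by (simp add: comp_def)
      then show ?thesis using k(2) \<psi>(1) by auto
    qed
    then show ?thesis using Aut_comp[OF g'(1) k(1)] by (intro bexI[of _ "\<lambda>x. k (g' x)"]) auto
  qed
  then show "type_action g p \<in> ?Y" using type_action_types[OF g pt]
    by (intro CollectI conjI allI impI)
qed

text \<open>Any element type is possible for the extension, since the external tuple acts only
  through its type \<open>q\<close> over \<open>M\<close>.\<close>

lemma FPT_imp_externally_definable_Ramsey: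
  fixes M :: "('r, 'a) struct"
  assumes M: "is_struct L M" and uh: "ultrahomogeneous L M" and FPT: "FPT L M"
  shows "externally_definable_Ramsey TYPE('n) L M"
  unfolding externally_definable_Ramsey_def
proof (intro ballI allI impI, elim conjE)
  fix A as and k :: nat and B and col :: "'a list \<Rightarrow> nat"
  assume A: "A \<in> age L M" and as: "enumerates as A" and B: "B \<in> age L M"
    and col: "col ` copies L M A as \<subseteq> {..<k}"
    and ext: "externally_definable TYPE('n) L M A as k col"
  from ext obtain N :: "('r, 'n) struct" and h es0 \<phi> where N: "is_struct L N"
    and h: "elementary_embedding L h M N" and es0: "es0 \<in> lists (universe N)"
    and ext': "\<forall>i<k. \<phi> i \<in> formulae L {} (length es0 + length as)"
      "\<forall>as'\<in>copies L M A as. \<forall>i<k. col as' = i \<longleftrightarrow> sat_tuple N (es0 @ map h as') (\<phi> i)"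
    unfolding externally_definable_def by (elim exE conjE) (rule that)
  have \<phi>: "\<phi> i \<in> formulae L {} (length es0 + length as)" if "i < k" for i using ext'(1) that by simp
  have col_iff: "col as' = i \<longleftrightarrow> sat_tuple N (es0 @ map h as') (\<phi> i)"
    if "as' \<in> copies L M A as" "i < k" for as' i using ext'(2) that by simp
  obtain w where w: "w \<in> universe N" using N unfolding is_struct_def by auto
  \<comment> \<open>The external tuple may be empty, but \<open>FPT\<close> speaks about
    \<open>n\<close>-types with \<open>n \<ge> 1\<close>; an arbitrary element is then
    supplied.\<close>
  define es where "es = (if es0 = [] then [w] else es0)"
  define n where "n = length es"
  have es: "es \<in> lists (universe N)" "n \<ge> 1" "length es0 \<le> n" "\<And>j. j < length es0 \<Longrightarrow> es ! j = es0 ! j"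
    using es0 w by (cases "es0 = []"; simp add: es_def n_def Suc_le_eq)+
  define q where "q = {\<psi> \<in> formulae L (universe M) n. sat_tuple N es (map_params h \<psi>)}"
  have q: "q \<in> types L M n" unfolding q_def by (rule tuple_type_types[OF M N h es(1)]) (simp add: n_def)
  define Y where "Y = {p \<in> types L M n. \<forall>F\<subseteq>p. finite F \<longrightarrow> (\<exists>g\<in>Aut L M. map_params g ` F \<subseteq> q)}"
  have "subflow L M n Y" unfolding Y_def by (rule orbit_closure_subflow[OF q])
  then have "\<exists>p\<in>Y. \<forall>g\<in>Aut L M. type_action g p = p"
    using FPT es(2) unfolding FPT_def by simp
  then obtain p where pY: "p \<in> Y" and p_fixed: "\<forall>g\<in>Aut L M. type_action g p = p" by (elim bexE)
  have p: "p \<in> types L M n"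
    "\<And>F. F \<subseteq> p \<Longrightarrow> finite F \<Longrightarrow> \<exists>g\<in>Aut L M. map_params g ` F \<subseteq> q"
    using pY by (simp_all add: Y_def)
  have fixed: "type_action g p = p" if "g \<in> Aut L M" for g using p_fixed that by simp
  \<comment> \<open>The formula over \<open>M\<close> saying that \<open>as'\<close> has colour
    \<open>i\<close>. By \<open>\<theta>_q\<close> below, \<open>q\<close> thereby records the whole
    colouring.\<close>
  define \<theta> where "\<theta> i as' = instantiate (length es0) as' (\<phi> i)" for i and as' :: "'a list"
  have as_A: "set as = universe A" "distinct as" using as by (simp_all add: enumerates_def)
  have cop: "set as' \<subseteq> universe M" "length as' = length as" if c: "as' \<in> copies L M A as" for as'
  proof -
    obtain f where "as' = map f as" "embedding L f A M" by (rule copiesE[OF c])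
    then show "set as' \<subseteq> universe M" "length as' = length as"
      using embedding_range[of L f A M] as_A by simp_all
  qed
  have \<theta>: "\<theta> i as' \<in> formulae L (universe M) n" if "i < k" "as' \<in> copies L M A as" for i as'
  proof -
    have "\<theta> i as' \<in> formulae L (universe M) (length es0)"
      unfolding \<theta>_def
      by (rule instantiate_mem_formulae) (use \<phi>[OF that(1)] cop[OF that(2)] in simp_all)
    then show ?thesis using es(3) by (auto simp: formulae_def)
  qed
  have \<theta>_q: "\<theta> i as' \<in> q \<longleftrightarrow> col as' = i" if "i < k" "as' \<in> copies L M A as" for i as'
  proof -
    have "\<theta> i as' \<in> q \<longleftrightarrow> sat_tuple N es (map_params h (\<theta> i as'))" using \<theta>[OF that] by (simp add: q_def)
    also have "\<dots> \<longleftrightarrow> sat_tuple N (es0 @ map h as') (\<phi> i)"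
      unfolding \<theta>_def by (rule sat_instantiate[where L = L])
        (use \<phi>[OF that(1)] cop[OF that(2)] es(4) in simp_all)
    also have "\<dots> \<longleftrightarrow> col as' = i" using col_iff[OF that(2,1)] by simp
    finally show ?thesis .
  qed
  have \<theta>_map: "map_params g (\<theta> i as') = \<theta> i (map g as')" for g i as'
    unfolding \<theta>_def by (rule map_params_instantiate)
  have cop_map: "map g as' \<in> copies L M A as" if c: "as' \<in> copies L M A as" and g: "g \<in> Aut L M" for g as'
  proof -
    obtain f where f: "as' = map f as" "embedding L f A M" by (rule copiesE[OF c])
    show ?thesis
      using copiesI[OF embedding_comp[OF f(2) embedding_Aut[OF g]], of as] by (simp add: f(1) comp_def)
  qed
  obtain fB where fB: "embedding L fB B M" and finB: "finite (universe B)" using B by (auto simp: age_def)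
  define X0 where "X0 = fB ` universe B"
  have X0: "X0 \<subseteq> universe M" "finite X0" using embedding_range[OF fB] finB by (auto simp: X0_def)
  define C where "C = {as' \<in> copies L M A as. set as' \<subseteq> X0}"
  have "finite C"
  proof (rule finite_subset)
    show "C \<subseteq> {xs. set xs \<subseteq> X0 \<and> length xs = length as}" using cop(2) by (auto simp: C_def)
  qed (rule finite_lists_length_eq[OF X0(2)])
  define T where "T = (\<lambda>(i, as'). \<theta> i as') ` ({..<k} \<times> C)"
  have T: "finite (T \<union> Neg ` T)" unfolding T_def using \<open>finite C\<close> by simp
  \<comment> \<open>Negations were added to \<open>T\<close> so that this finite part of
    \<open>p\<close> decides each formula in \<open>T\<close>.\<close>
  define F where "F = (T \<union> Neg ` T) \<inter> p"
  have "finite F" "F \<subseteq> p" using T by (simp_all add: F_def)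
  then have "\<exists>g\<in>Aut L M. map_params g ` F \<subseteq> q" by (intro p(2))
  then obtain g where g: "g \<in> Aut L M" "map_params g ` F \<subseteq> q" by (elim bexE)
  \<comment> \<open>On copies inside \<open>X0\<close>, the type \<open>p\<close> records the
    colours of their images under \<open>g\<close>.\<close>
  have \<theta>_p: "\<theta> i as' \<in> p \<longleftrightarrow> col (map g as') = i" if "i < k" "as' \<in> C" for i as'
  proof -
    have c: "as' \<in> copies L M A as" using that(2) by (simp add: C_def)
    have t: "\<theta> i as' \<in> T" using that by (auto simp: T_def)
    have "\<theta> i as' \<in> p \<longleftrightarrow> \<theta> i (map g as') \<in> q"
    proof
      assume "\<theta> i as' \<in> p"
      then have "\<theta> i as' \<in> F" using t by (simp add: F_def)
      then have "map_params g (\<theta> i as') \<in> q" by (intro subsetD[OF g(2)] imageI)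
      then show "\<theta> i (map g as') \<in> q" by (simp add: \<theta>_map)
    next
      assume A: "\<theta> i (map g as') \<in> q"
      show "\<theta> i as' \<in> p"
      proof (rule ccontr)
        assume "\<theta> i as' \<notin> p"
        then have "Neg (\<theta> i as') \<in> p" using types_Neg[OF p(1) \<theta>[OF that(1) c]] by simp
        then have "Neg (\<theta> i as') \<in> F" using t by (simp add: F_def)
        then have "map_params g (Neg (\<theta> i as')) \<in> q" by (intro subsetD[OF g(2)] imageI)
        then have "Neg (\<theta> i (map g as')) \<in> q" by (simp add: \<theta>_map)
        then show False using A types_Neg[OF q \<theta>[OF that(1) cop_map[OF c g(1)]]] by simp
      qed
    qed
    then show ?thesis using \<theta>_q[OF that(1) cop_map[OF c g(1)]] by simp
  qed
  obtain g' where g': "g' \<in> Aut L M" "\<And>x. x \<in> universe M \<Longrightarrow> g' (g x) = x"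
    "\<And>x. x \<in> universe M \<Longrightarrow> g (g' x) = x" using Aut_inverse[OF g(1)] by blast
  \<comment> \<open>The required copy of \<open>B\<close>: \<open>g\<close> has moved
    \<open>X0\<close> to a place where the colouring can be read off from \<open>p\<close>.\<close>
  define X where "X = g ` X0"
  have XM: "X \<subseteq> universe M" using X0(1) AutD(4)[OF g(1)] by (auto simp: X_def)
  have pull: "\<exists>as0\<in>C. as' = map g as0" if c: "as' \<in> copies L (substruct M X) A as" for as'
  proof -
    obtain f where f: "as' = map f as" "embedding L f A (substruct M X)" by (rule copiesE[OF c])
    have fX: "f ` universe A \<subseteq> X" using embedding_range[OF f(2)] by (simp add: substruct_simps)
    have "map (\<lambda>x. g' (f x)) as \<in> copies L M A as"
      by (rule copiesI[OF embedding_comp[OF embedding_substructD[OF f(2) XM] embedding_Aut[OF g'(1)]]])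
    moreover have "g' (f x) \<in> X0" if "x \<in> universe A" for x
    proof -
      have "f x \<in> g ` X0" using fX that by (auto simp: X_def)
      then show ?thesis using g'(2) X0(1) by auto
    qed
    then have "set (map (\<lambda>x. g' (f x)) as) \<subseteq> X0" using as_A by auto
    moreover have "as' = map g (map (\<lambda>x. g' (f x)) as)"
      unfolding f(1) map_map using fX XM as_A g'(3) by (intro map_cong refl) (auto simp: subset_iff)
    ultimately show ?thesis by (intro bexI[of _ "map (\<lambda>x. g' (f x)) as"]) (simp_all add: C_def)
  qed
  have const: "col as1 = col as2"
    if 1: "as1 \<in> copies L (substruct M X) A as" and 2: "as2 \<in> copies L (substruct M X) A as" for as1 as2
  proof -
    obtain b1 where b1: "b1 \<in> C" "as1 = map g b1" using pull[OF 1] by auto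
    obtain b2 where b2: "b2 \<in> C" "as2 = map g b2" using pull[OF 2] by auto
    have c: "b1 \<in> copies L M A as" "b2 \<in> copies L M A as" using b1(1) b2(1) by (simp_all add: C_def)
    have "as1 \<in> copies L M A as" using cop_map[OF c(1) g(1)] b1(2) by simp
    then have "col as1 \<in> {..<k}" by (intro subsetD[OF col] imageI)
    then have k: "col as1 < k" by simp
    have "\<theta> (col as1) b1 \<in> p" using \<theta>_p[OF k b1(1)] b1(2) by simp
    have "finite (universe A)" using A by (simp add: age_def)
    \<comment> \<open>\<open>\<gamma>\<close> need not preserve \<open>X0\<close>; it only serves to
      compare two formulae in the fixed type \<open>p\<close>.\<close>
    then obtain \<gamma> where \<gamma>: "\<gamma> \<in> Aut L M" "b2 = map \<gamma> b1"
      by (rule copies_conjugate[OF uh _ as_A(1) c])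
    have "map_params \<gamma> (\<theta> (col as1) b1) \<in> type_action \<gamma> p"
      using \<open>\<theta> (col as1) b1 \<in> p\<close> by (simp add: type_action_def)
    then have "\<theta> (col as1) b2 \<in> p" unfolding fixed[OF \<gamma>(1)] \<theta>_map \<gamma>(2) .
    then show ?thesis using \<theta>_p[OF k b2(1)] b2(2) by simp
  qed
  have "isomorphism L (\<lambda>x. g (fB x)) B (substruct M X)"
    using embedding_image_isomorphism[OF embedding_comp[OF fB embedding_Aut[OF g(1)]]]
    by (simp add: X_def X0_def image_image)
  then have "isomorphic L (substruct M X) B"
    unfolding isomorphic_def by (intro exI) (rule isomorphism_inv_into)
  moreover have "\<exists>i. \<forall>as'\<in>copies L (substruct M X) A as. col as' = i"
  proof (cases "copies L (substruct M X) A as = {}")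
    case False
    then obtain as1 where "as1 \<in> copies L (substruct M X) A as" by auto
    then have "\<forall>as'\<in>copies L (substruct M X) A as. col as' = col as1" by (intro ballI const)
    then show ?thesis by (rule exI)
  qed simp
  ultimately show "\<exists>X\<subseteq>universe M. isomorphic L (substruct M X) B \<and>
      (\<exists>i. \<forall>as'\<in>copies L (substruct M X) A as. col as' = i)" using XM by (intro exI[of _ X]) simp
qed

section \<open>The Ramsey property yields fixed points\<close>

text \<open>Members of the age live on natural numbers, so the structure on the elements of
  \<open>ms\<close> is carried over to their positions in the list.\<close>

definition tuple_struct :: "'r language \<Rightarrow> ('r, 'a) struct \<Rightarrow> 'a list \<Rightarrow> ('r, nat) struct" where
  "tuple_struct L M ms = \<lparr>universe = {..<length ms},
    interp = (\<lambda>R. {xs \<in> lists {..<length ms}. length xs = arity L R \<and> map ((!) ms) xs \<in> interp M R})\<rparr>"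

lemma universe_tuple_struct [simp]: "universe (tuple_struct L M ms) = {..<length ms}"
  by (simp add: tuple_struct_def)

lemma image_nth_lessThan: "(!) ms ` {..<length ms} = set ms"
  using nth_image[of "length ms" ms] by (simp add: lessThan_atLeast0)

lemma embedding_tuple_struct:
  assumes "distinct ms" "set ms \<subseteq> universe M"
  shows "embedding L ((!) ms) (tuple_struct L M ms) M"
  unfolding embedding_def
proof (intro conjI ballI impI)
  show "inj_on ((!) ms) (universe (tuple_struct L M ms))" using assms(1) by (simp add: inj_on_nth)
  show "(!) ms ` universe (tuple_struct L M ms) \<subseteq> universe M" using assms(2) by (simp add: image_nth_lessThan)
qed (simp add: tuple_struct_def)

lemma tuple_struct_age:
  assumes "distinct ms" "set ms \<subseteq> universe M" "ms \<noteq> []"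
  shows "tuple_struct L M ms \<in> age L M"
  unfolding age_def mem_Collect_eq
proof (intro conjI)
  show "is_struct L (tuple_struct L M ms)"
    unfolding is_struct_def
  proof (intro conjI ballI)
    show "universe (tuple_struct L M ms) \<noteq> {}" using assms(3) by (simp add: lessThan_empty_iff)
  qed (rule subsetI, simp add: tuple_struct_def)
  show "\<exists>f. embedding L f (tuple_struct L M ms) M"
    by (rule exI) (rule embedding_tuple_struct[OF assms(1,2)])
qed simp

lemma subflow_types: "subflow L M n Y \<Longrightarrow> Y \<subseteq> types L M n"
  using closedin_subset[of "Stone_space L M n" Y] by (simp add: subflow_def topspace_Stone_space)

text \<open>Stated for arbitrary subflows so that it applies again inside the subflow of types that
  already treat other formulae invariantly.\<close>

lemma Ramsey_finitely_invariant_type: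
  fixes M :: "('r, 'a) struct"
  assumes L: "countable (symbols L)" and M: "is_struct L M" and uh: "ultrahomogeneous L M"
    and Ramsey: "externally_definable_Ramsey TYPE('a + nat + 'n) L M"
    and Y: "subflow L M n Y" and \<phi>: "\<phi> \<in> formulae L (universe M) n"
    and \<Gamma>: "finite \<Gamma>" "\<Gamma> \<subseteq> Aut L M"
  shows "\<exists>p\<in>Y. \<forall>g\<in>\<Gamma>. map_params g \<phi> \<in> p \<longleftrightarrow> \<phi> \<in> p"
proof -
  obtain q where q: "q \<in> Y" using Y by (auto simp: subflow_def)
  have qt: "q \<in> types L M n" using subflow_types[OF Y] q by (rule subsetD)
  obtain N :: "('r, 'a + nat + 'n) struct" and h es
    where N: "is_struct L N" "elementary_embedding L h M N" "es \<in> lists (universe N)" "length es = n"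
      "\<forall>\<phi>\<in>formulae L (universe M) n. \<phi> \<in> q \<longleftrightarrow> sat_tuple N es (map_params h \<phi>)"
    by (rule type_realised[OF L M qt]) (rule that)
  obtain u where u: "u \<in> universe M" using M by (auto simp: is_struct_def)
  \<comment> \<open>Structures are non-empty, so an element \<open>u\<close> joins the parameters in
    case \<open>\<phi>\<close> has none.\<close>
  have "finite (insert u (params \<phi>))" using finite_params[of \<phi>] by simp
  then obtain ms where ms: "set ms = insert u (params \<phi>)" "distinct ms"
    using finite_distinct_list[of "insert u (params \<phi>)"] by auto
  have msM: "set ms \<subseteq> universe M" "ms \<noteq> []" using ms(1) u \<phi> by (auto simp: formulae_def)
  have \<phi>ms: "\<phi> \<in> formulae L (set ms) n" using \<phi> ms(1) by (auto simp: formulae_def)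
  \<comment> \<open>With the identity included, \<open>\<phi>\<close> itself is among the translates
    that receive a common truth value.\<close>
  define \<Gamma>' where "\<Gamma>' = insert (\<lambda>x. x) \<Gamma>"
  have \<Gamma>': "finite \<Gamma>'" "\<And>g. g \<in> \<Gamma>' \<Longrightarrow> g \<in> Aut L M" using \<Gamma> Aut_id by (auto simp: \<Gamma>'_def)
  have "finite (\<Union>g\<in>\<Gamma>'. g ` set ms)" using \<Gamma>'(1) by simp
  then obtain bs where bs: "set bs = (\<Union>g\<in>\<Gamma>'. g ` set ms)" "distinct bs"
    using finite_distinct_list[of "\<Union>g\<in>\<Gamma>'. g ` set ms"] by auto
  have bsM: "set bs \<subseteq> universe M" unfolding bs(1) using msM(1) AutD(4)[OF \<Gamma>'(2)] by (auto simp: subset_iff)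
  have "set ms \<subseteq> set bs" unfolding bs(1) \<Gamma>'_def by auto
  then have "bs \<noteq> []" using msM(2) by auto
  define A where "A = tuple_struct L M ms"
  define B where "B = tuple_struct L M bs"
  have AB: "A \<in> age L M" "B \<in> age L M"
    unfolding A_def B_def using tuple_struct_age ms(2) msM bs(2) bsM \<open>bs \<noteq> []\<close> by blast+
  define as where "as = [0..<length ms]"
  have as: "enumerates as A" "length as = length ms"
    by (auto simp: enumerates_def as_def A_def)
  define \<psi> :: "('r, 'a + nat + 'n) formula" where "\<psi> = generalise n ms \<phi>"
  have \<psi>: "\<psi> \<in> formulae L {} (n + length ms)" unfolding \<psi>_def by (rule generalise_mem_formulae[OF \<phi>ms])
  \<comment> \<open>On copies of \<open>ms\<close>, this is the truth value in \<open>q\<close> of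
    \<open>\<phi>\<close> with \<open>ms\<close> replaced by \<open>as'\<close>.
    \<open>\<psi>\<close> and its negation define the two colours.\<close>
  define col where "col as' = (if sat_tuple N (es @ map h as') \<psi> then 1 else 0 :: nat)" for as'
  have "externally_definable TYPE('a + nat + 'n) L M A as 2 col"
    unfolding externally_definable_def
  proof (intro exI conjI)
    show "\<forall>i<2. (if i = 1 then \<psi> else Neg \<psi>) \<in> formulae L {} (length es + length as)" for i :: nat
      using \<psi> N(4) as(2) by (simp add: Neg_mem_formulae)
    show "\<forall>as'\<in>copies L M A as. \<forall>i<2. col as' = i \<longleftrightarrow>
        sat_tuple N (es @ map h as') (if i = 1 then \<psi> else Neg \<psi>)"
      by (auto simp: col_def less_2_cases_iff)
  qed (use N in simp_all)
  moreover have "col ` copies L M A as \<subseteq> {..<2}" by (auto simp: col_def)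
  ultimately have "\<exists>X\<subseteq>universe M. isomorphic L (substruct M X) B \<and>
      (\<exists>i. \<forall>as'\<in>copies L (substruct M X) A as. col as' = i)"
    using Ramsey[unfolded externally_definable_Ramsey_def, rule_format, OF AB(1) as(1) _ AB(2), of 2 col]
    by simp
  then obtain X i where X: "X \<subseteq> universe M" "isomorphic L (substruct M X) B"
    and i: "\<forall>as'\<in>copies L (substruct M X) A as. col as' = i"
    by (elim exE conjE) (rule that)
  obtain f where f: "isomorphism L f (substruct M X) B" using X(2) by (auto simp: isomorphic_def)
  have "isomorphism L ((!) bs) B (substruct M (set bs))"
    using embedding_image_isomorphism[OF embedding_tuple_struct[OF bs(2) bsM]]
    by (simp add: B_def image_nth_lessThan)
  then have iso: "isomorphism L (\<lambda>x. bs ! f x) (substruct M X) (substruct M (set bs))"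
    by (rule isomorphism_comp[OF f])
  then have bij: "inj_on (\<lambda>x. bs ! f x) X" "(\<lambda>x. bs ! f x) ` X = set bs"
    by (simp_all add: isomorphism_def embedding_def substruct_simps)
  then have "finite X" by (metis finite_imageD finite_set)
  \<comment> \<open>The homogeneous set \<open>X\<close> may lie anywhere in \<open>M\<close>.
    Ultrahomogeneity takes it to the prescribed set of translates in \<open>bs\<close>, and
    \<open>q\<close> is moved along with it.\<close>
  then obtain \<gamma> where \<gamma>: "\<gamma> \<in> Aut L M" "\<forall>x\<in>X. \<gamma> x = bs ! f x"
    using uh[unfolded ultrahomogeneous_def, rule_format, of X "set bs"] iso X(1) bsM by blast
  then have \<gamma>X: "\<gamma> ` X = set bs" using bij(2) by simp
  obtain \<gamma>' where \<gamma>': "\<gamma>' \<in> Aut L M" "\<And>x. x \<in> universe M \<Longrightarrow> \<gamma>' (\<gamma> x) = x"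
    "\<And>x. x \<in> universe M \<Longrightarrow> \<gamma> (\<gamma>' x) = x" using Aut_inverse[OF \<gamma>(1)] by blast
  have key: "map_params g \<phi> \<in> type_action \<gamma> q \<longleftrightarrow> i = 1" if g: "g \<in> \<Gamma>'" for g
  proof -
    have gA: "g \<in> Aut L M" by (rule \<Gamma>'(2)[OF g])
    \<comment> \<open>The translate of \<open>\<phi>\<close> by \<open>g\<close> belongs to
      \<open>type_action \<gamma> q\<close> iff its translate by \<open>?k\<close> belongs to
      \<open>q\<close>, and \<open>?k\<close> takes \<open>ms\<close> into the homogeneous set
      \<open>X\<close>.\<close>
    let ?k = "\<lambda>x. \<gamma>' (g x)"
    have kA: "?k \<in> Aut L M" by (rule Aut_comp[OF gA \<gamma>'(1)])
    have emb: "embedding L (\<lambda>j. ?k (ms ! j)) A M"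
      unfolding A_def by (rule embedding_comp[OF embedding_tuple_struct[OF ms(2) msM(1)] embedding_Aut[OF kA]])
    have "?k x \<in> X" if "x \<in> set ms" for x
    proof -
      have "g x \<in> \<gamma> ` X" unfolding \<gamma>X bs(1) using g that by auto
      then obtain y where y: "y \<in> X" "g x = \<gamma> y" by auto
      then show ?thesis using \<gamma>'(2)[of y] X(1) by auto
    qed
    then have "(\<lambda>j. ?k (ms ! j)) ` universe A \<subseteq> X" by (auto simp: A_def)
    then have "map (\<lambda>j. ?k (ms ! j)) as \<in> copies L (substruct M X) A as"
      by (intro copiesI embedding_substructI[OF emb])
    moreover have "map (\<lambda>j. ?k (ms ! j)) as = map ?k ms"
      by (rule nth_equalityI) (simp_all add: as_def)
    ultimately have "col (map ?k ms) = i" using i by simp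
    moreover have "sat_tuple N (es @ map h (map ?k ms)) \<psi> \<longleftrightarrow> sat_tuple N es (map_params (\<lambda>x. h (?k x)) \<phi>)"
      unfolding \<psi>_def by (rule sat_generalise[OF \<phi>ms N(4)]) simp_all
    moreover have "map_params (\<lambda>x. h (?k x)) \<phi> = map_params h (map_params ?k \<phi>)"
      by (simp add: formula.map_comp comp_def)
    moreover have "map_params ?k \<phi> \<in> q \<longleftrightarrow> sat_tuple N es (map_params h (map_params ?k \<phi>))"
      by (rule bspec[OF N(5) Aut_formulae[OF kA \<phi>]])
    moreover have "map_params g \<phi> \<in> type_action \<gamma> q \<longleftrightarrow> map_params \<gamma>' (map_params g \<phi>) \<in> q"
      by (rule mem_type_action[OF types_subset[OF qt] Aut_formulae[OF gA \<phi>]]) (fact \<gamma>'(2), fact \<gamma>'(3))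
    moreover have "map_params \<gamma>' (map_params g \<phi>) = map_params ?k \<phi>"
      by (simp add: formula.map_comp comp_def)
    ultimately show ?thesis by (auto simp: col_def split: if_splits)
  qed
  have "map_params (\<lambda>x. x) \<phi> = \<phi>" by (rule formula.map_ident)
  then have "\<phi> \<in> type_action \<gamma> q \<longleftrightarrow> i = 1" using key[of "\<lambda>x. x"] by (simp add: \<Gamma>'_def)
  moreover have "type_action \<gamma> q \<in> Y" using Y q \<gamma>(1) by (simp add: subflow_def)
  ultimately show ?thesis using key by (intro bexI[of _ "type_action \<gamma> q"] ballI) (simp_all add: \<Gamma>'_def)
qed

text \<open>By \<open>types_Neg\<close>, containing a given formula is a clopen condition.\<close>

lemma closedin_same_truth_value:
  assumes \<phi>: "\<phi> \<in> formulae L (universe M) n" and \<psi>: "\<psi> \<in> formulae L (universe M) n"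
  shows "closedin (Stone_space L M n) {p \<in> types L M n. \<psi> \<in> p \<longleftrightarrow> \<phi> \<in> p}"
proof (rule closedin_Stone_spaceI)
  fix p assume p: "p \<in> types L M n" and "p \<notin> {p \<in> types L M n. \<psi> \<in> p \<longleftrightarrow> \<phi> \<in> p}"
  then have p': "\<psi> \<in> p \<longleftrightarrow> \<phi> \<notin> p" by simp
  define F where "F = (if \<psi> \<in> p then {\<psi>, Neg \<phi>} else {Neg \<psi>, \<phi>})"
  have "F \<subseteq> p" using p' types_Neg[OF p \<phi>] types_Neg[OF p \<psi>] by (simp add: F_def)
  moreover have "finite F" by (simp add: F_def)
  moreover have "q \<notin> {p \<in> types L M n. \<psi> \<in> p \<longleftrightarrow> \<phi> \<in> p}" if q: "q \<in> types L M n" "F \<subseteq> q" for q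
    using q(2) types_Neg[OF q(1) \<phi>] types_Neg[OF q(1) \<psi>] by (cases "\<psi> \<in> p") (simp_all add: F_def)
  ultimately show "\<exists>F\<subseteq>p. finite F \<and> (\<forall>q\<in>types L M n. F \<subseteq> q \<longrightarrow> q \<notin> {p \<in> types L M n. \<psi> \<in> p \<longleftrightarrow> \<phi> \<in> p})"
    by (intro exI[of _ F]) simp
qed (rule Collect_subset)

text \<open>Compactness for indexed families, applied once with automorphisms and once with formulae
  as indices.\<close>

lemma closed_family_Int_nonempty:
  assumes Y: "closedin (Stone_space L M n) Y"
    and closed: "\<And>i. i \<in> I \<Longrightarrow> closedin (Stone_space L M n) (C i)"
    and fip: "\<And>J. finite J \<Longrightarrow> J \<subseteq> I \<Longrightarrow> \<exists>p\<in>Y. \<forall>i\<in>J. p \<in> C i"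
  shows "\<exists>p\<in>Y. \<forall>i\<in>I. p \<in> C i"
proof -
  have "compactin (Stone_space L M n) Y"
    using closedin_compact_space[OF compact_space_Stone_space Y] .
  moreover have "Y \<inter> \<Inter>\<F> \<noteq> {}" if \<F>: "finite \<F>" "\<F> \<subseteq> C ` I" for \<F>
  proof -
    obtain J where J: "J \<subseteq> I" "finite J" "\<F> = C ` J"
      using finite_subset_image[OF \<F>] by (elim exE conjE) (rule that)
    obtain p where "p \<in> Y" "\<forall>i\<in>J. p \<in> C i" using fip[OF J(2,1)] by (elim bexE)
    then have "p \<in> Y \<inter> \<Inter>\<F>" using J(3) by simp
    then show ?thesis by auto
  qed
  moreover have "\<forall>D\<in>C ` I. closedin (Stone_space L M n) D" using closed by simp
  ultimately have "Y \<inter> \<Inter>(C ` I) \<noteq> {}"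
    unfolding compactin_fip by (elim conjE allE[of _ "C ` I"]) simp
  then obtain p where "p \<in> Y \<inter> \<Inter>(C ` I)" by auto
  then show ?thesis by (intro bexI[of _ p]) simp_all
qed

lemma Ramsey_imp_FPT:
  fixes M :: "('r, 'a) struct"
  assumes L: "countable (symbols L)" and M: "is_struct L M" and uh: "ultrahomogeneous L M"
    and Ramsey: "externally_definable_Ramsey TYPE('a + nat + 'n) L M"
  shows "FPT L M"
  unfolding FPT_def
proof (intro allI impI)
  fix n :: nat and Y assume Y: "subflow L M n Y"
  define I where "I = formulae L (universe M) n"
  define E where "E \<phi> g = {p \<in> types L M n. map_params g \<phi> \<in> p \<longleftrightarrow> \<phi> \<in> p}" for \<phi> :: "('r, 'a) formula" and g
  \<comment> \<open>The types that contain all translates of \<open>\<phi>\<close> or none.\<close>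
  define C where "C \<phi> = (\<Inter>g\<in>Aut L M. E \<phi> g)" for \<phi>
  have E: "closedin (Stone_space L M n) (E \<phi> g)" if "\<phi> \<in> I" "g \<in> Aut L M" for \<phi> g
    unfolding E_def using that Aut_formulae[OF that(2)]
    by (intro closedin_same_truth_value) (simp_all add: I_def)
  have C: "closedin (Stone_space L M n) (C \<phi>)" if "\<phi> \<in> I" for \<phi>
    unfolding C_def by (rule closedin_Inter) (use E[OF that] Aut_id in auto)
  \<comment> \<open>A translate of \<open>\<phi>\<close> belongs to \<open>type_action g p\<close>
    iff another translate belongs to \<open>p\<close>, and \<open>p\<close> contains all of them or
    none.\<close>
  have C_invariant: "type_action g p \<in> C \<phi>" if \<phi>: "\<phi> \<in> I" and g: "g \<in> Aut L M" and p: "p \<in> C \<phi>" for g p \<phi>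
  proof -
    obtain g' where g': "g' \<in> Aut L M" "\<And>x. x \<in> universe M \<Longrightarrow> g' (g x) = x"
      "\<And>x. x \<in> universe M \<Longrightarrow> g (g' x) = x" using Aut_inverse[OF g] by blast
    have pE: "p \<in> E \<phi> k" if "k \<in> Aut L M" for k using p that by (simp add: C_def)
    have pt: "p \<in> types L M n" using pE[OF Aut_id] by (simp add: E_def)
    have act: "map_params k \<phi> \<in> type_action g p \<longleftrightarrow> \<phi> \<in> p" if k: "k \<in> Aut L M" for k
    proof -
      have "map_params k \<phi> \<in> type_action g p \<longleftrightarrow> map_params g' (map_params k \<phi>) \<in> p"
        by (rule mem_type_action[OF types_subset[OF pt] Aut_formulae[OF k]])
          (use \<phi> in \<open>simp add: I_def\<close>, fact g'(2), fact g'(3))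
      also have "map_params g' (map_params k \<phi>) = map_params (\<lambda>x. g' (k x)) \<phi>"
        by (simp add: formula.map_comp comp_def)
      also have "\<dots> \<in> p \<longleftrightarrow> \<phi> \<in> p" using pE[OF Aut_comp[OF k g'(1)]] by (simp add: E_def)
      finally show ?thesis .
    qed
    have "\<phi> \<in> type_action g p \<longleftrightarrow> \<phi> \<in> p" using act[OF Aut_id] by (simp add: formula.map_ident)
    then show ?thesis using act type_action_types[OF g pt] by (simp add: C_def E_def)
  qed
  have finite_step: "subflow L M n {p \<in> Y. \<forall>\<phi>\<in>S. p \<in> C \<phi>}" if "finite S" "S \<subseteq> I" for S
    using that
  proof (induction S)
    case empty
    then show ?case using Y by simp
  next
    case (insert \<phi> S)
    define Z where "Z = {p \<in> Y. \<forall>\<phi>\<in>S. p \<in> C \<phi>}"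
    have Z: "subflow L M n Z" unfolding Z_def using insert by simp
    have \<phi>: "\<phi> \<in> I" using insert.prems by simp
    \<comment> \<open>Compactness passes from finitely many automorphisms to the whole group, inside
      the subflow \<open>Z\<close> already obtained for \<open>S\<close>.\<close>
    have "\<exists>p\<in>Z. \<forall>g\<in>Aut L M. p \<in> E \<phi> g"
    proof (rule closed_family_Int_nonempty)
      show "closedin (Stone_space L M n) Z" using Z by (simp add: subflow_def)
      show "closedin (Stone_space L M n) (E \<phi> g)" if "g \<in> Aut L M" for g by (rule E[OF \<phi> that])
      fix \<Gamma> assume \<Gamma>: "finite \<Gamma>" "\<Gamma> \<subseteq> Aut L M"
      have "\<exists>p\<in>Z. \<forall>g\<in>\<Gamma>. map_params g \<phi> \<in> p \<longleftrightarrow> \<phi> \<in> p"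
        by (rule Ramsey_finitely_invariant_type[OF L M uh Ramsey Z _ \<Gamma>]) (use \<phi> in \<open>simp add: I_def\<close>)
      then obtain p where p: "p \<in> Z" "\<forall>g\<in>\<Gamma>. map_params g \<phi> \<in> p \<longleftrightarrow> \<phi> \<in> p" by (elim bexE)
      have "p \<in> types L M n" using subflow_types[OF Z] p(1) by (rule subsetD)
      then show "\<exists>p\<in>Z. \<forall>g\<in>\<Gamma>. p \<in> E \<phi> g" using p by (intro bexI[of _ p]) (simp_all add: E_def)
    qed
    then obtain p where "p \<in> Z" "p \<in> C \<phi>" by (auto simp: C_def)
    have "subflow L M n (Z \<inter> C \<phi>)"
      unfolding subflow_def
    proof (intro conjI ballI)
      show "Z \<inter> C \<phi> \<noteq> {}" using \<open>p \<in> Z\<close> \<open>p \<in> C \<phi>\<close> by auto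
      show "closedin (Stone_space L M n) (Z \<inter> C \<phi>)"
        by (rule closedin_Int) (use Z C[OF \<phi>] in \<open>simp_all add: subflow_def\<close>)
      fix g r assume g: "g \<in> Aut L M" and r: "r \<in> Z \<inter> C \<phi>"
      have "type_action g r \<in> Z" using Z g r by (simp add: subflow_def)
      moreover have "type_action g r \<in> C \<phi>" by (rule C_invariant[OF \<phi> g]) (use r in simp)
      ultimately show "type_action g r \<in> Z \<inter> C \<phi>" by simp
    qed
    moreover have "Z \<inter> C \<phi> = {p \<in> Y. \<forall>\<phi>\<in>insert \<phi> S. p \<in> C \<phi>}" by (auto simp: Z_def)
    ultimately show ?case by simp
  qed
  have "\<exists>p\<in>Y. \<forall>\<phi>\<in>I. p \<in> C \<phi>"
  proof (rule closed_family_Int_nonempty)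
    show "closedin (Stone_space L M n) Y" using Y by (simp add: subflow_def)
    show "\<exists>p\<in>Y. \<forall>\<phi>\<in>J. p \<in> C \<phi>" if "finite J" "J \<subseteq> I" for J
    proof -
      have "{p \<in> Y. \<forall>\<phi>\<in>J. p \<in> C \<phi>} \<noteq> {}" using finite_step[OF that] by (simp add: subflow_def)
      then obtain p where "p \<in> {p \<in> Y. \<forall>\<phi>\<in>J. p \<in> C \<phi>}" unfolding ex_in_conv[symmetric] by (elim exE)
      then show ?thesis by (intro bexI[of _ p]) simp_all
    qed
  qed (rule C)
  then obtain p where p: "p \<in> Y" "\<forall>\<phi>\<in>I. p \<in> C \<phi>" by (elim bexE)
  have pt: "p \<in> types L M n" using subflow_types[OF Y] p(1) by (rule subsetD)
  \<comment> \<open>One inclusion suffices, because complete types are maximal.\<close>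
  have "type_action g p = p" if g: "g \<in> Aut L M" for g
  proof (rule types_eqI[OF type_action_types[OF g pt] pt], rule subsetI)
    fix \<psi> assume "\<psi> \<in> type_action g p"
    then obtain \<phi> where \<phi>: "\<phi> \<in> p" "\<psi> = map_params g \<phi>" by (auto simp: type_action_def)
    then have "\<phi> \<in> I" using types_subset[OF pt] by (auto simp: I_def)
    then have "p \<in> C \<phi>" using p(2) by simp
    then have "p \<in> E \<phi> g" using g by (simp add: C_def)
    then show "\<psi> \<in> p" using \<phi> by (simp add: E_def)
  qed
  then show "\<exists>p\<in>Y. \<forall>g\<in>Aut L M. type_action g p = p" using p(1) by (intro bexI[of _ p]) simp_all
qed

theorem theorem5p1:
  fixes L :: "'r language" and M :: "('r, 'a) struct"
  assumes "countable (symbols L)"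
    and "is_struct L M"
    and "ultrahomogeneous L M"
  shows "(FPT L M \<longrightarrow> externally_definable_Ramsey TYPE('a + nat + 'n) L M) \<and>
    (countable_age L M \<longrightarrow>
      (externally_definable_Ramsey TYPE('a + nat + 'n) L M \<longleftrightarrow> FPT L M))"
proof -
  have "externally_definable_Ramsey TYPE('a + nat + 'n) L M" if "FPT L M"
    using assms(2,3) that by (rule FPT_imp_externally_definable_Ramsey)
  moreover have "FPT L M" if "externally_definable_Ramsey TYPE('a + nat + 'n) L M"
    using assms that by (rule Ramsey_imp_FPT)
  ultimately show ?thesis by (intro conjI impI iffI)
qed

end
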